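(* Let $A$ be a commutative DG ring, and let $u:A\to B$ be a central homomorphism of nonpositive DG rings. Suppose we are given two factorizations $u=v\circ\tilde{u}$ and $u=v'\circ\tilde{u}'$, with $$A\xrightarrow{\tilde{u}}\tilde{B}\xrightarrow{v}B,\qquad A\xrightarrow{\tilde{u}'}\tilde{B}'\xrightarrow{v'}B,$$ in the category of nonpositive central DG $A$-rings, such that $v$ is a surjective quasi-isomorphism, and $\tilde{u}'$ is noncommutative semi-free. Let $w_0,w_1:\tilde{B}'\to\tilde{B}$ be homomorphisms of DG rings that satisfy $w_i\circ\tilde{u}'=\tilde{u}$ and $v\circ w_i=v'$ for $i=0,1$. Then there is an $A$-linear DG ring homotopy $\gamma:w_0\Rightarrow w_1$ that satisfies $v\circ\gamma=0$.
   Context: DG rings are associative unital cohomologically $\mathbb{Z}$-graded rings with a differential $\mathrm{d}$ of degree $1$ satisfying the graded Leibniz rule; homomorphisms preserve degree, unit and differential. $A$ is nonpositive if $A^i=0$ for $i>0$. A commutative DG ring is a nonpositive DG ring with $ab=(-1)^{ij}ba$ for $a\in A^i$, $b\in A^j$ and $a^2=0$ for $a$ of odd degree. The center of a DG ring $B$ consists of sums of homogeneous $b$ with $bc=(-1)^{ij}cb$ for all $c\in B^j$ ($b\in B^i$). For a commutative DG ring $A$, a homomorphism $A\to B$ is central if its image lies in the center of $B$; a nonpositive central DG $A$-ring is a nonpositive DG ring $B$ with a central homomorphism $A\to B$, and morphisms are DG ring homomorphisms compatible with the homomorphisms from $A$. $A^\natural$ denotes the graded ring underlying $A$, and $\mathbb{Z}\langle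 X\rangle$ the noncommutative polynomial ring on a graded set $X$. A nonpositive central homomorphism $A\to B$ is noncommutative semi-free if there is an isomorphism of graded $A^\natural$-rings $B^\natural\cong A^\natural\otimes_{\mathbb{Z}}\mathbb{Z}\langle X\rangle$ for some graded set $X=\coprod_{i\le 0}X^i$. DG ring homotopy: for DG ring homomorphisms $u_0,u_1:A\to B$, a $u_0$-$u_1$-derivation of degree $-1$ is an additive homomorphism $\gamma:A\to B$ of degree $-1$ with $\gamma(a_0a_1)=\gamma(a_0)\,u_1(a_1)+(-1)^{k_0}u_0(a_0)\,\gamma(a_1)$ for $a_i\in A^{k_i}$. A DG ring homotopy $\gamma:u_0\Rightarrow u_1$ is such a derivation satisfying $\mathrm{d}_B\circ\gamma+\gamma\circ\mathrm{d}_A=u_1-u_0$. A degree $k$ additive map $\phi$ between DG $A$-modules is $A$-linear if $\phi(am)=(-1)^{ik}a\phi(m)$ for $a\in A^i$. *)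

theory Defs
  imports "HOL-Algebra.QuotRing" "HOL-Algebra.Generated_Groups" "HOL-Algebra.Free_Abelian_Groups"
begin

section \<open>Graded rings and DG rings\<close>

record 'a gring = "'a ring" +
  gr :: "int \<Rightarrow> 'a set"

record 'a dgring = "'a gring" +
  dif :: "'a \<Rightarrow> 'a"

text \<open>\<open>ksign R k x\<close> is $(-1)^k x$.\<close>

definition ksign :: "('a, 'm) ring_scheme \<Rightarrow> int \<Rightarrow> 'a \<Rightarrow> 'a" where
  "ksign R k x = (if even k then x else \<ominus>\<^bsub>R\<^esub> x)"

definition is_decomp :: "('a, 'm) gring_scheme \<Rightarrow> 'a \<Rightarrow> (int \<Rightarrow> 'a) \<Rightarrow> bool" where
  "is_decomp R x f \<longleftrightarrow>
     (\<forall>i. f i \<in> gr R i) \<and> finite {i. f i \<noteq> \<zero>\<^bsub>R\<^esub>} \<and>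
     x = (\<Oplus>\<^bsub>R\<^esub>i\<in>{i. f i \<noteq> \<zero>\<^bsub>R\<^esub>}. f i)"

text \<open>A graded ring is the internal direct sum of its homogeneous components. The zero ring is
  allowed.\<close>

locale graded_ring = ring R for R :: "('a, 'm) gring_scheme" (structure) +
  assumes gr_subgroup: "additive_subgroup (gr R i) R"
    and gr_direct: "x \<in> carrier R \<Longrightarrow> \<exists>!f. is_decomp R x f"
    and gr_one: "\<one> \<in> gr R 0"
    and gr_mult: "\<lbrakk>a \<in> gr R i; b \<in> gr R j\<rbrakk> \<Longrightarrow> a \<otimes> b \<in> gr R (i + j)"

text \<open>The homogeneous components of \<open>x\<close>; meaningful for \<open>x\<close> in the carrier of a graded ring.\<close>

definition hparts :: "('a, 'm) gring_scheme \<Rightarrow> 'a \<Rightarrow> int \<Rightarrow> 'a" where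
  "hparts R x = (THE f. is_decomp R x f)"

definition hsupp :: "('a, 'm) gring_scheme \<Rightarrow> 'a \<Rightarrow> int set" where
  "hsupp R x = {i. hparts R x i \<noteq> \<zero>\<^bsub>R\<^esub>}"

locale dg_ring = graded_ring R for R :: "('a, 'm) dgring_scheme" (structure) +
  assumes dif_add: "\<lbrakk>a \<in> carrier R; b \<in> carrier R\<rbrakk> \<Longrightarrow> dif R (a \<oplus> b) = dif R a \<oplus> dif R b"
    and dif_degree: "a \<in> gr R i \<Longrightarrow> dif R a \<in> gr R (i + 1)"
    and dif_dif: "a \<in> carrier R \<Longrightarrow> dif R (dif R a) = \<zero>"
    and dif_leibniz: "\<lbrakk>a \<in> gr R i; b \<in> gr R j\<rbrakk> \<Longrightarrow>
          dif R (a \<otimes> b) = dif R a \<otimes> b \<oplus> ksign R i (a \<otimes> dif R b)"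

definition nonpositive :: "('a, 'm) gring_scheme \<Rightarrow> bool" where
  "nonpositive R \<longleftrightarrow> (\<forall>i>0. gr R i = {\<zero>\<^bsub>R\<^esub>})"

locale comm_dg_ring = dg_ring R for R :: "('a, 'm) dgring_scheme" (structure) +
  assumes nonpos: "nonpositive R"
    and graded_comm: "\<lbrakk>a \<in> gr R i; b \<in> gr R j\<rbrakk> \<Longrightarrow> a \<otimes> b = ksign R (i * j) (b \<otimes> a)"
    and odd_square: "\<lbrakk>a \<in> gr R i; odd i\<rbrakk> \<Longrightarrow> a \<otimes> a = \<zero>"

definition dg_hom :: "('a, 'm) dgring_scheme \<Rightarrow> ('b, 'n) dgring_scheme \<Rightarrow> ('a \<Rightarrow> 'b) set" where
  "dg_hom R S = {f \<in> ring_hom R S.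
     (\<forall>i. f ` gr R i \<subseteq> gr S i) \<and> (\<forall>x\<in>carrier R. f (dif R x) = dif S (f x))}"

definition hcentral :: "('a, 'm) gring_scheme \<Rightarrow> int \<Rightarrow> 'a set" where
  "hcentral R i = {b \<in> gr R i. \<forall>j. \<forall>c\<in>gr R j. b \<otimes>\<^bsub>R\<^esub> c = ksign R (i * j) (c \<otimes>\<^bsub>R\<^esub> b)}"

definition gcenter :: "('a, 'm) gring_scheme \<Rightarrow> 'a set" where
  "gcenter R = {(\<Oplus>\<^bsub>R\<^esub>i\<in>I. f i) | f I. finite I \<and> (\<forall>i\<in>I. f i \<in> hcentral R i)}"

definition central_hom :: "('a, 'm) dgring_scheme \<Rightarrow> ('b, 'n) dgring_scheme \<Rightarrow> ('a \<Rightarrow> 'b) set" where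
  "central_hom A B = {u \<in> dg_hom A B. u ` carrier A \<subseteq> gcenter B}"

definition nonpos_central_dg_ring ::
  "('a, 'm) dgring_scheme \<Rightarrow> ('b, 'n) dgring_scheme \<Rightarrow> ('a \<Rightarrow> 'b) \<Rightarrow> bool" where
  "nonpos_central_dg_ring A B u \<longleftrightarrow> dg_ring B \<and> nonpositive B \<and> u \<in> central_hom A B"

text \<open>Morphisms \<open>(B, u) \<rightarrow> (C, w)\<close> of central DG \<open>A\<close>-rings.\<close>

definition central_dg_mor ::
  "('a, 'm) dgring_scheme \<Rightarrow> ('b, 'n) dgring_scheme \<Rightarrow> ('a \<Rightarrow> 'b) \<Rightarrow>
   ('c, 'l) dgring_scheme \<Rightarrow> ('a \<Rightarrow> 'c) \<Rightarrow> ('b \<Rightarrow> 'c) set" where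
  "central_dg_mor A B u C w = {f \<in> dg_hom B C. \<forall>a\<in>carrier A. f (u a) = w a}"

section \<open>Cohomology and quasi-isomorphisms\<close>

definition cocycles :: "('a, 'm) dgring_scheme \<Rightarrow> int \<Rightarrow> 'a set" where
  "cocycles R i = {x \<in> gr R i. dif R x = \<zero>\<^bsub>R\<^esub>}"

definition coboundaries :: "('a, 'm) dgring_scheme \<Rightarrow> int \<Rightarrow> 'a set" where
  "coboundaries R i = dif R ` gr R (i - 1)"

definition cohomology :: "('a, 'm) dgring_scheme \<Rightarrow> int \<Rightarrow> 'a set monoid" where
  "cohomology R i = (add_monoid R)\<lparr>carrier := cocycles R i\<rparr> Mod coboundaries R i"

text \<open>For a DG ring homomorphism \<open>f\<close>, the coset of a cocycle \<open>x\<close> is sent to the coset of \<open>f x\<close>.\<close>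

definition cohomology_map :: "('b, 'n) dgring_scheme \<Rightarrow> ('a \<Rightarrow> 'b) \<Rightarrow> int \<Rightarrow> 'a set \<Rightarrow> 'b set" where
  "cohomology_map S f i c = (\<Union>x\<in>c. coboundaries S i +>\<^bsub>S\<^esub> f x)"

definition quasi_iso ::
  "('a, 'm) dgring_scheme \<Rightarrow> ('b, 'n) dgring_scheme \<Rightarrow> ('a \<Rightarrow> 'b) \<Rightarrow> bool" where
  "quasi_iso R S f \<longleftrightarrow>
     f \<in> dg_hom R S \<and> (\<forall>i. cohomology_map S f i \<in> iso (cohomology R i) (cohomology S i))"

section \<open>Noncommutative polynomial rings\<close>

text \<open>The monomials of $\mathbb{Z}\langle X\rangle$ are the words in $X = \coprod_{i \le 0} X^i$, whose
  elements are pairs \<open>(i, x)\<close> with \<open>x \<in> X i\<close>.\<close>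

definition nonpos_coprod :: "(int \<Rightarrow> 'x set) \<Rightarrow> (int \<times> 'x) set" where
  "nonpos_coprod X = {(i, x). i \<le> 0 \<and> x \<in> X i}"

definition word_degree :: "(int \<times> 'x) list \<Rightarrow> int" where
  "word_degree w = sum_list (map fst w)"

definition nc_poly_ring :: "(int \<times> 'x) set \<Rightarrow> ((int \<times> 'x) list \<Rightarrow>\<^sub>0 int) gring" where
  "nc_poly_ring Y =
     \<lparr>carrier = carrier (free_Abelian_group (lists Y)),
      monoid.mult = (\<lambda>p q. frag_extend (\<lambda>v. frag_extend (\<lambda>w. frag_of (v @ w)) q) p),
      one = frag_of [],
      ring.zero = 0,
      add = (+),
      gr = (\<lambda>i. carrier (free_Abelian_group {w \<in> lists Y. word_degree w = i}))\<rparr>"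

section \<open>Tensor products of graded rings over the integers\<close>

text \<open>$R \otimes_{\mathbb{Z}} S$ is the free abelian group on the product of the carriers modulo
  biadditivity, with multiplication
  $(a \otimes m)(b \otimes n) = (-1)^{jk}\, ab \otimes mn$ for $m \in S^j$, $b \in R^k$.
  For inhomogeneous $m$ and $b$ one expands into homogeneous components. The resulting product on
  the free abelian group becomes associative and unital only after passing to the quotient, so
  \<open>tensor_pre\<close> is not a ring; \<open>FactRing\<close> is used for its underlying operations on cosets.\<close>

definition tensor_gen_mult ::
  "('a, 'm) gring_scheme \<Rightarrow> ('b, 'n) gring_scheme \<Rightarrow> 'a \<times> 'b \<Rightarrow> 'a \<times> 'b \<Rightarrow> ('a \<times> 'b \<Rightarrow>\<^sub>0 int)" where
  "tensor_gen_mult R S p q =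
     (\<Sum>j\<in>hsupp S (snd p). \<Sum>k\<in>hsupp R (fst q).
        frag_cmul (if even (j * k) then 1 else - 1)
          (frag_of (fst p \<otimes>\<^bsub>R\<^esub> hparts R (fst q) k, hparts S (snd p) j \<otimes>\<^bsub>S\<^esub> snd q)))"

definition tensor_pre ::
  "('a, 'm) gring_scheme \<Rightarrow> ('b, 'n) gring_scheme \<Rightarrow> ('a \<times> 'b \<Rightarrow>\<^sub>0 int) ring" where
  "tensor_pre R S =
     \<lparr>carrier = carrier (free_Abelian_group (carrier R \<times> carrier S)),
      monoid.mult = (\<lambda>x y. frag_extend (\<lambda>p. frag_extend (\<lambda>q. tensor_gen_mult R S p q) y) x),
      one = frag_of (\<one>\<^bsub>R\<^esub>, \<one>\<^bsub>S\<^esub>),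
      ring.zero = 0,
      add = (+)\<rparr>"

definition tensor_rels ::
  "('a, 'm) gring_scheme \<Rightarrow> ('b, 'n) gring_scheme \<Rightarrow> ('a \<times> 'b \<Rightarrow>\<^sub>0 int) set" where
  "tensor_rels R S =
     {frag_of (a \<oplus>\<^bsub>R\<^esub> a', m) - frag_of (a, m) - frag_of (a', m) | a a' m.
        a \<in> carrier R \<and> a' \<in> carrier R \<and> m \<in> carrier S} \<union>
     {frag_of (a, m \<oplus>\<^bsub>S\<^esub> m') - frag_of (a, m) - frag_of (a, m') | a m m'.
        a \<in> carrier R \<and> m \<in> carrier S \<and> m' \<in> carrier S}"

definition tensor_ideal ::
  "('a, 'm) gring_scheme \<Rightarrow> ('b, 'n) gring_scheme \<Rightarrow> ('a \<times> 'b \<Rightarrow>\<^sub>0 int) set" where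
  "tensor_ideal R S = generate (free_Abelian_group (carrier R \<times> carrier S)) (tensor_rels R S)"

definition pure_tensor ::
  "('a, 'm) gring_scheme \<Rightarrow> ('b, 'n) gring_scheme \<Rightarrow> 'a \<Rightarrow> 'b \<Rightarrow> ('a \<times> 'b \<Rightarrow>\<^sub>0 int) set" where
  "pure_tensor R S a m = tensor_ideal R S +>\<^bsub>tensor_pre R S\<^esub> frag_of (a, m)"

definition graded_tensor ::
  "('a, 'm) gring_scheme \<Rightarrow> ('b, 'n) gring_scheme \<Rightarrow> ('a \<times> 'b \<Rightarrow>\<^sub>0 int) set gring" where
  "graded_tensor R S =
     ring.extend (tensor_pre R S Quot tensor_ideal R S)
       \<lparr>gr = (\<lambda>l. generate (add_monoid (tensor_pre R S Quot tensor_ideal R S))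
          {pure_tensor R S a m | a m i j. a \<in> gr R i \<and> m \<in> gr S j \<and> i + j = l})\<rparr>"

section \<open>Noncommutative semi-free homomorphisms\<close>

text \<open>HOL cannot quantify over types, so the type from which the generators are drawn is a
  parameter.\<close>

definition nc_semi_free ::
  "'x itself \<Rightarrow> ('a, 'm) dgring_scheme \<Rightarrow> ('b, 'n) dgring_scheme \<Rightarrow> ('a \<Rightarrow> 'b) \<Rightarrow> bool" where
  "nc_semi_free (_ :: 'x itself) A B u \<longleftrightarrow>
     (\<exists>(X :: int \<Rightarrow> 'x set) \<phi>.
        let P = nc_poly_ring (nonpos_coprod X); T = graded_tensor A P in
          \<phi> \<in> ring_iso T B \<and>
          (\<forall>i. \<phi> ` gr T i = gr B i) \<and>
          (\<forall>a\<in>carrier A. \<phi> (pure_tensor A P a \<one>\<^bsub>P\<^esub>) = u a))"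

section \<open>DG ring homotopies\<close>

definition additive_map_deg ::
  "('a, 'm) gring_scheme \<Rightarrow> ('b, 'n) gring_scheme \<Rightarrow> int \<Rightarrow> ('a \<Rightarrow> 'b) set" where
  "additive_map_deg R S k =
     {f \<in> hom (add_monoid R) (add_monoid S). \<forall>i. f ` gr R i \<subseteq> gr S (i + k)}"

definition twisted_derivation ::
  "('a, 'm) gring_scheme \<Rightarrow> ('b, 'n) gring_scheme \<Rightarrow> ('a \<Rightarrow> 'b) \<Rightarrow> ('a \<Rightarrow> 'b) \<Rightarrow> ('a \<Rightarrow> 'b) \<Rightarrow> bool"
  where
  "twisted_derivation R S u0 u1 \<gamma> \<longleftrightarrow>
     \<gamma> \<in> additive_map_deg R S (- 1) \<and>
     (\<forall>k0 k1. \<forall>a0\<in>gr R k0. \<forall>a1\<in>gr R k1.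
        \<gamma> (a0 \<otimes>\<^bsub>R\<^esub> a1) = \<gamma> a0 \<otimes>\<^bsub>S\<^esub> u1 a1 \<oplus>\<^bsub>S\<^esub> ksign S k0 (u0 a0 \<otimes>\<^bsub>S\<^esub> \<gamma> a1))"

definition dg_ring_homotopy ::
  "('a, 'm) dgring_scheme \<Rightarrow> ('b, 'n) dgring_scheme \<Rightarrow> ('a \<Rightarrow> 'b) \<Rightarrow> ('a \<Rightarrow> 'b) \<Rightarrow> ('a \<Rightarrow> 'b) \<Rightarrow> bool"
  where
  "dg_ring_homotopy R S u0 u1 \<gamma> \<longleftrightarrow>
     twisted_derivation R S u0 u1 \<gamma> \<and>
     (\<forall>x\<in>carrier R. dif S (\<gamma> x) \<oplus>\<^bsub>S\<^esub> \<gamma> (dif R x) = u1 x \<ominus>\<^bsub>S\<^esub> u0 x)"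

text \<open>\<open>A\<close>-linearity in degree \<open>k\<close> of a map between the DG \<open>A\<close>-modules underlying the DG \<open>A\<close>-rings
  \<open>(B, u)\<close> and \<open>(C, w)\<close>, on which \<open>a\<close> acts by left multiplication with \<open>u a\<close> and \<open>w a\<close>.\<close>

definition dg_linear ::
  "('a, 'm) dgring_scheme \<Rightarrow> ('b, 'n) dgring_scheme \<Rightarrow> ('a \<Rightarrow> 'b) \<Rightarrow>
   ('c, 'l) dgring_scheme \<Rightarrow> ('a \<Rightarrow> 'c) \<Rightarrow> int \<Rightarrow> ('b \<Rightarrow> 'c) \<Rightarrow> bool" where
  "dg_linear A B u C w k \<phi> \<longleftrightarrow>
     \<phi> \<in> additive_map_deg B C k \<and>
     (\<forall>i. \<forall>a\<in>gr A i. \<forall>x\<in>carrier B.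
        \<phi> (u a \<otimes>\<^bsub>B\<^esub> x) = ksign C (i * k) (w a \<otimes>\<^bsub>C\<^esub> \<phi> x))"

end

theory Submission
  imports Defs
begin

text \<open>
  A \<open>w\<^sub>0\<close>-\<open>w\<^sub>1\<close>-derivation on a noncommutative semi-free \<open>B\<close> can be prescribed freely on the letters
  \<open>X\<close>. The Leibniz rule forces its values on words (\<open>word_der\<close>), \<open>A\<close>-linearity forces its values on
  the multiples of words, and since $A \otimes \mathbb{Z}\langle X\rangle$ is free over \<open>A\<close> on the words,
  nothing else has to be checked for an additive extension to exist (\<open>additive_extension\<close>). That the
  extension \<open>der\<close> is again a derivation (\<open>der_leibniz\<close>) is a matter of signs: coefficients from \<open>A\<close> are
  moved to the front, both in the source and in the target, which is possible because both
  homomorphisms from \<open>A\<close> are central.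

  The homotopy identity $d\gamma + \gamma d = w_1 - w_0$ compares two derivations of degree 0 that
  vanish on \<open>A\<close>, so it holds everywhere as soon as it holds on the letters (\<open>contracts_ge\<close>). The letters
  are treated by descending degree. For a letter \<open>x\<close> of degree \<open>i\<close> one has to find $\gamma(x)$ with
  $d\gamma(x) = w_1(x) - w_0(x) - \gamma(dx)$. Because \<open>A\<close> and \<open>X\<close> are nonpositive, an element of
  degree $i + 1$ such as $dx$ involves only letters of degree at least $i + 1$; hence
  $\gamma(dx)$ is already determined, and the identity already holds at $dx$. Applied to $dx$, the
  identity says exactly that the right hand side is a cocycle. It is sent to 0 by \<open>v\<close>, provided that
  the earlier values are. The kernel of a surjective quasi-isomorphism is acyclic (\<open>kernel_acyclic\<close>),
  so $\gamma(x)$ can be chosen in it (\<open>primitive_exists\<close>). A derivation whose values on letters lie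
  in the kernel takes all its values there (\<open>der_in_kernel\<close>).

  What remains is to extract words and coefficients from the quotient that represents the tensor
  product. The multiplication of cosets is meaningful because the subgroup of relations absorbs
  products (\<open>tensor_ideal_absorbs\<close>), which rests on the additivity of homogeneous components.
\<close>

section \<open>Graded rings\<close>

context ring
begin

lemma ksign_closed [simp, intro]: "x \<in> carrier R \<Longrightarrow> ksign R i x \<in> carrier R"
  by (simp add: ksign_def)

lemma ksign_add:
  "\<lbrakk>x \<in> carrier R; y \<in> carrier R\<rbrakk> \<Longrightarrow> ksign R i (x \<oplus> y) = ksign R i x \<oplus> ksign R i y"
  by (simp add: ksign_def minus_add)

lemma ksign_eq_zero_iff [simp]: "x \<in> carrier R \<Longrightarrow> ksign R i x = \<zero> \<longleftrightarrow> x = \<zero>"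
  by (auto simp: ksign_def)

lemma ksign_l_mult:
  "\<lbrakk>x \<in> carrier R; y \<in> carrier R\<rbrakk> \<Longrightarrow> ksign R i x \<otimes> y = ksign R i (x \<otimes> y)"
  by (simp add: ksign_def l_minus)

lemma ksign_r_mult:
  "\<lbrakk>x \<in> carrier R; y \<in> carrier R\<rbrakk> \<Longrightarrow> x \<otimes> ksign R i y = ksign R i (x \<otimes> y)"
  by (simp add: ksign_def r_minus)

lemma ksign_ksign: "x \<in> carrier R \<Longrightarrow> ksign R i (ksign R j x) = ksign R (i + j) x"
  by (simp add: ksign_def)

end

lemma ksign_parity: "even (i - j) \<Longrightarrow> ksign R i x = ksign R j x"
  by (auto simp: ksign_def)

lemma ksign_even: "even i \<Longrightarrow> ksign R i x = x"
  by (simp add: ksign_def)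

lemma ring_hom_ksign:
  assumes "ring R" "ring S" "f \<in> ring_hom R S" "x \<in> carrier R"
  shows "f (ksign R i x) = ksign S i (f x)"
proof -
  interpret ring_hom_ring R S f using assms by (simp add: ring_hom_ringI2)
  show ?thesis using assms(4) by (simp add: ksign_def)
qed

context graded_ring
begin

lemma gr_closed: "x \<in> gr R i \<Longrightarrow> x \<in> carrier R"
  using additive_subgroup.a_Hcarr[OF gr_subgroup] .

lemma gr_zero [simp]: "\<zero> \<in> gr R i"
  using additive_subgroup.zero_closed[OF gr_subgroup] .

lemma gr_add: "\<lbrakk>x \<in> gr R i; y \<in> gr R i\<rbrakk> \<Longrightarrow> x \<oplus> y \<in> gr R i"
  using additive_subgroup.a_closed[OF gr_subgroup] .

lemma gr_a_inv: "x \<in> gr R i \<Longrightarrow> \<ominus> x \<in> gr R i"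
  using additive_subgroup.a_inv_closed[OF gr_subgroup] .

lemma gr_minus: "\<lbrakk>x \<in> gr R i; y \<in> gr R i\<rbrakk> \<Longrightarrow> x \<ominus> y \<in> gr R i"
  by (simp add: a_minus_def gr_add gr_a_inv)

lemma gr_ksign: "x \<in> gr R i \<Longrightarrow> ksign R k x \<in> gr R i"
  by (simp add: ksign_def gr_a_inv)

lemma hparts_is_decomp: "x \<in> carrier R \<Longrightarrow> is_decomp R x (hparts R x)"
  unfolding hparts_def by (rule theI'[OF gr_direct])

lemma hparts_eqI: "\<lbrakk>x \<in> carrier R; is_decomp R x f\<rbrakk> \<Longrightarrow> hparts R x = f"
  using gr_direct hparts_is_decomp by blast

lemma hparts_gr: "x \<in> carrier R \<Longrightarrow> hparts R x i \<in> gr R i"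
  using hparts_is_decomp by (simp add: is_decomp_def)

lemma hparts_closed [simp]: "x \<in> carrier R \<Longrightarrow> hparts R x i \<in> carrier R"
  using hparts_gr gr_closed by blast

lemma finite_hsupp: "x \<in> carrier R \<Longrightarrow> finite (hsupp R x)"
  using hparts_is_decomp by (simp add: is_decomp_def hsupp_def)

lemma finsum_hparts:
  assumes "x \<in> carrier R" "finite I" "hsupp R x \<subseteq> I"
  shows "(\<Oplus>i\<in>I. hparts R x i) = x"
proof -
  have "x = (\<Oplus>i\<in>hsupp R x. hparts R x i)"
    using hparts_is_decomp[OF assms(1)] by (simp add: is_decomp_def hsupp_def)
  also have "\<dots> = (\<Oplus>i\<in>I. hparts R x i)"
    by (rule add.finprod_mono_neutral_cong_left) (use assms in \<open>auto simp: hsupp_def\<close>)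
  finally show ?thesis by (rule sym)
qed

lemma hparts_finsum:
  assumes "finite I" "\<And>i. i \<in> I \<Longrightarrow> f i \<in> gr R i"
  shows "hparts R (\<Oplus>i\<in>I. f i) j = (if j \<in> I then f j else \<zero>)"
proof -
  let ?g = "\<lambda>j. if j \<in> I then f j else \<zero>"
  have fc: "f \<in> I \<rightarrow> carrier R" using assms(2) gr_closed by blast
  have sub: "{i. ?g i \<noteq> \<zero>} \<subseteq> I" by auto
  have "(\<Oplus>i\<in>I. f i) = (\<Oplus>i\<in>{i. ?g i \<noteq> \<zero>}. ?g i)"
    by (rule add.finprod_mono_neutral_cong_right) (use assms fc sub in auto)
  then have "is_decomp R (\<Oplus>i\<in>I. f i) ?g"
    using assms sub finite_subset[OF sub assms(1)] by (auto simp: is_decomp_def)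
  from hparts_eqI[OF finsum_closed[OF fc] this] show ?thesis by simp
qed

lemma hparts_homogeneous:
  assumes "x \<in> gr R i" shows "hparts R x j = (if j = i then x else \<zero>)"
  using hparts_finsum[of "{i}" "\<lambda>_. x" j] assms gr_closed[OF assms] by simp

lemma hsupp_homogeneous: "x \<in> gr R i \<Longrightarrow> hsupp R x \<subseteq> {i}"
  by (auto simp: hsupp_def hparts_homogeneous split: if_splits)

lemma hparts_add:
  assumes "x \<in> carrier R" "y \<in> carrier R"
  shows "hparts R (x \<oplus> y) j = hparts R x j \<oplus> hparts R y j"
proof -
  let ?I = "insert j (hsupp R x \<union> hsupp R y)"
  have fin: "finite ?I" using assms finite_hsupp by simp
  have "x \<oplus> y = (\<Oplus>i\<in>?I. hparts R x i) \<oplus> (\<Oplus>i\<in>?I. hparts R y i)"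
    by (subst (1 2) finsum_hparts) (use assms fin in auto)
  also have "\<dots> = (\<Oplus>i\<in>?I. hparts R x i \<oplus> hparts R y i)"
    by (rule finsum_addf[symmetric]) (use assms in auto)
  finally show ?thesis
    using hparts_finsum[OF fin, of "\<lambda>i. hparts R x i \<oplus> hparts R y i" j] assms
    by (simp add: gr_add hparts_gr)
qed

lemma graded_induct [consumes 1, case_names homogeneous add]:
  assumes x: "x \<in> carrier R"
    and hom: "\<And>i x. x \<in> gr R i \<Longrightarrow> P x"
    and add: "\<And>x y. \<lbrakk>x \<in> carrier R; y \<in> carrier R; P x; P y\<rbrakk> \<Longrightarrow> P (x \<oplus> y)"
  shows "P x"
proof -
  have "P (\<Oplus>i\<in>I. hparts R x i)" if "finite I" for I
    using that
  proof induction
    case empty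
    then show ?case using hom[OF gr_zero] by simp
  next
    case (insert i I)
    then show ?case using x hom[OF hparts_gr[OF x]] by (simp add: add Pi_def)
  qed
  from this[OF finite_hsupp[OF x]] show ?thesis
    using finsum_hparts[OF x finite_hsupp[OF x]] by simp
qed

text \<open>The additive map that acts as $(-1)^i$ in degree $i$. It makes $a \mapsto (-1)^{|a|} a$ available
  for inhomogeneous $a$, where the sign itself has no meaning.\<close>

definition parity_involution :: "'a \<Rightarrow> 'a" where
  "parity_involution x = (\<Oplus>i\<in>hsupp R x. ksign R i (hparts R x i))"

lemma parity_involution_eq:
  assumes "x \<in> carrier R" "finite I" "hsupp R x \<subseteq> I"
  shows "parity_involution x = (\<Oplus>i\<in>I. ksign R i (hparts R x i))"
  unfolding parity_involution_def
  by (rule add.finprod_mono_neutral_cong_left) (use assms in \<open>auto simp: hsupp_def\<close>)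

lemma parity_involution_closed [simp]:
  "x \<in> carrier R \<Longrightarrow> parity_involution x \<in> carrier R"
  unfolding parity_involution_def by (rule finsum_closed) auto

lemma parity_involution_homogeneous:
  "x \<in> gr R i \<Longrightarrow> parity_involution x = ksign R i x"
  using parity_involution_eq[of x "{i}"] hsupp_homogeneous[of x i] gr_closed[of x i]
  by (simp add: hparts_homogeneous)

lemma parity_involution_add:
  assumes "x \<in> carrier R" "y \<in> carrier R"
  shows "parity_involution (x \<oplus> y) = parity_involution x \<oplus> parity_involution y"
proof -
  let ?I = "hsupp R x \<union> hsupp R y \<union> hsupp R (x \<oplus> y)"
  have fin: "finite ?I" using assms finite_hsupp by simp
  have "parity_involution (x \<oplus> y) = (\<Oplus>i\<in>?I. ksign R i (hparts R x i) \<oplus> ksign R i (hparts R y i))"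
    using parity_involution_eq[of "x \<oplus> y" ?I] fin assms by (simp add: hparts_add ksign_add)
  also have "\<dots> = (\<Oplus>i\<in>?I. ksign R i (hparts R x i)) \<oplus> (\<Oplus>i\<in>?I. ksign R i (hparts R y i))"
    by (rule finsum_addf) (use assms in auto)
  also have "\<dots> = parity_involution x \<oplus> parity_involution y"
    by (subst (1 2) parity_involution_eq[where I = ?I]) (use assms fin in auto)
  finally show ?thesis .
qed

text \<open>Being central is defined through some decomposition into central homogeneous elements; since
  decompositions are unique, a homogeneous central element is its own component.\<close>

lemma gcenter_homogeneous:
  assumes "x \<in> gcenter R" "x \<in> gr R i" "c \<in> gr R j"
  shows "x \<otimes> c = ksign R (i * j) (c \<otimes> x)"
proof -
  obtain f I where fI: "finite I" "\<And>i. i \<in> I \<Longrightarrow> f i \<in> hcentral R i" "x = (\<Oplus>i\<in>I. f i)"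
    using assms(1) by (auto simp: gcenter_def)
  have "x = hparts R x i" using hparts_homogeneous[OF assms(2)] by simp
  also have "\<dots> = (if i \<in> I then f i else \<zero>)"
    unfolding fI(3) by (rule hparts_finsum) (use fI in \<open>auto simp: hcentral_def\<close>)
  finally have "x = \<zero> \<or> x \<in> hcentral R i" using fI(2) by (auto split: if_splits)
  then show ?thesis using assms(3) gr_closed[OF assms(3)] by (auto simp: hcentral_def ksign_def)
qed

end

context dg_ring
begin

lemma dif_closed [simp]: "x \<in> carrier R \<Longrightarrow> dif R x \<in> carrier R"
proof (induction rule: graded_induct)
  case (homogeneous i x)
  then show ?case using dif_degree gr_closed by blast
qed (simp add: dif_add)

lemma dif_zero [simp]: "dif R \<zero> = \<zero>"
  using dif_add[of \<zero> \<zero>] by (metis dif_closed l_zero zero_closed add.r_cancel_one)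

lemma dif_a_inv: "x \<in> carrier R \<Longrightarrow> dif R (\<ominus> x) = \<ominus> dif R x"
  using dif_add[of x "\<ominus> x"] by (metis dif_closed dif_zero a_inv_closed r_neg minus_equality a_comm)

lemma dif_ksign: "x \<in> carrier R \<Longrightarrow> dif R (ksign R i x) = ksign R i (dif R x)"
  by (simp add: ksign_def dif_a_inv)

end

lemma dg_homD:
  assumes "f \<in> dg_hom R S"
  shows "f \<in> ring_hom R S" "x \<in> gr R i \<Longrightarrow> f x \<in> gr S i"
    "x \<in> carrier R \<Longrightarrow> f (dif R x) = dif S (f x)"
  using assms by (auto simp: dg_hom_def)

lemma dg_hom_hparts:
  assumes "graded_ring R" "graded_ring S" "f \<in> dg_hom R S" "x \<in> carrier R"
  shows "hparts S (f x) i = f (hparts R x i)"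
proof -
  interpret R: graded_ring R by fact
  interpret S: graded_ring S by fact
  interpret ring_hom_ring R S f
    using assms by (simp add: ring_hom_ringI2 R.ring_axioms S.ring_axioms dg_homD)
  show ?thesis
    using assms(4)
  proof (induction rule: R.graded_induct)
    case (homogeneous j x)
    then have "f x \<in> gr S j" by (rule dg_homD(2)[OF assms(3)])
    with homogeneous show ?case by (simp add: R.hparts_homogeneous S.hparts_homogeneous)
  qed (simp add: R.hparts_add S.hparts_add)
qed

section \<open>The noncommutative polynomial ring\<close>

lemma nc_poly_ring_simps [simp]:
  "carrier (nc_poly_ring Y) = {p. Poly_Mapping.keys p \<subseteq> lists Y}"
  "\<zero>\<^bsub>nc_poly_ring Y\<^esub> = 0"
  "\<one>\<^bsub>nc_poly_ring Y\<^esub> = frag_of []"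
  "p \<oplus>\<^bsub>nc_poly_ring Y\<^esub> q = p + q"
  "gr (nc_poly_ring Y) i = {p. Poly_Mapping.keys p \<subseteq> {w \<in> lists Y. word_degree w = i}}"
  by (simp_all add: nc_poly_ring_def free_Abelian_group_def)

lemma nc_poly_ring_mult:
  "p \<otimes>\<^bsub>nc_poly_ring Y\<^esub> q = frag_extend (\<lambda>v. frag_extend (\<lambda>w. frag_of (v @ w)) q) p"
  by (simp add: nc_poly_ring_def)

lemma frag_extend_plus: "frag_extend (\<lambda>x. f x + g x) c = frag_extend f c + frag_extend g c"
  by (simp add: frag_extend_def frag_cmul_distrib2 sum.distrib)

lemma frag_extend_minus_fun: "frag_extend (\<lambda>x. f x - g x) c = frag_extend f c - frag_extend g c"
  using frag_extend_plus[of "\<lambda>x. f x - g x" g c] by (simp add: algebra_simps)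

lemma keys_frag_extend_subset:
  assumes "Poly_Mapping.keys c \<subseteq> S" "\<And>x. x \<in> S \<Longrightarrow> Poly_Mapping.keys (f x) \<subseteq> T"
  shows "Poly_Mapping.keys (frag_extend f c) \<subseteq> T"
  by (rule order_trans[OF keys_frag_extend]) (use assms in blast)

lemma keys_plus_subset:
  "\<lbrakk>Poly_Mapping.keys x \<subseteq> S; Poly_Mapping.keys y \<subseteq> S\<rbrakk> \<Longrightarrow> Poly_Mapping.keys (x + y) \<subseteq> S"
  by (rule order_trans[OF keys_add]) simp

lemma word_degree_simps [simp]:
  "word_degree [] = 0" "word_degree (y # w) = fst y + word_degree w"
  "word_degree (v @ w) = word_degree v + word_degree w"
  by (simp_all add: word_degree_def)

lemma nc_poly_ring_mult_words [simp]:
  "frag_of v \<otimes>\<^bsub>nc_poly_ring Y\<^esub> frag_of w = frag_of (v @ w)"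
  by (simp add: nc_poly_ring_mult)

lemma nc_poly_ring_ring: "ring (nc_poly_ring Y)"
proof (rule ringI)
  let ?P = "nc_poly_ring Y"
  show "abelian_group ?P"
  proof (rule abelian_groupI)
    show "\<exists>y\<in>carrier ?P. y \<oplus>\<^bsub>?P\<^esub> x = \<zero>\<^bsub>?P\<^esub>" if "x \<in> carrier ?P" for x
      using that by (intro bexI[of _ "- x"]) simp_all
  qed (simp_all add: algebra_simps keys_plus_subset)
  have assoc: "(p \<otimes>\<^bsub>?P\<^esub> q) \<otimes>\<^bsub>?P\<^esub> r = p \<otimes>\<^bsub>?P\<^esub> (q \<otimes>\<^bsub>?P\<^esub> r)" for p q r
  proof -
    have 1: "(frag_of v \<otimes>\<^bsub>?P\<^esub> frag_of w) \<otimes>\<^bsub>?P\<^esub> r = frag_of v \<otimes>\<^bsub>?P\<^esub> (frag_of w \<otimes>\<^bsub>?P\<^esub> r)" for v w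
      using subset_UNIV[of "Poly_Mapping.keys r"]
      by (induction r rule: frag_induction) (auto simp: nc_poly_ring_mult frag_extend_diff)
    have 2: "(frag_of v \<otimes>\<^bsub>?P\<^esub> q) \<otimes>\<^bsub>?P\<^esub> r = frag_of v \<otimes>\<^bsub>?P\<^esub> (q \<otimes>\<^bsub>?P\<^esub> r)" for v
      using subset_UNIV[of "Poly_Mapping.keys q"]
      by (induction q rule: frag_induction)
        (use 1 in \<open>auto simp: nc_poly_ring_mult frag_extend_diff frag_extend_minus_fun\<close>)
    show ?thesis
      using subset_UNIV[of "Poly_Mapping.keys p"]
      by (induction p rule: frag_induction)
        (use 2 in \<open>auto simp: nc_poly_ring_mult frag_extend_diff\<close>)
  qed
  show "monoid ?P"
  proof (rule monoidI)
    show "x \<otimes>\<^bsub>?P\<^esub> y \<in> carrier ?P" if "x \<in> carrier ?P" "y \<in> carrier ?P" for x y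
      using that unfolding nc_poly_ring_mult nc_poly_ring_simps mem_Collect_eq
      by (elim keys_frag_extend_subset) (simp add: keys_frag_of)
    show "\<one>\<^bsub>?P\<^esub> \<otimes>\<^bsub>?P\<^esub> p = p" for p
      using frag_expansion[of p] by (simp add: nc_poly_ring_mult)
    show "p \<otimes>\<^bsub>?P\<^esub> \<one>\<^bsub>?P\<^esub> = p" for p
      using frag_expansion[of p] by (simp add: nc_poly_ring_mult)
  qed (auto simp: assoc)
  show "(x \<oplus>\<^bsub>?P\<^esub> y) \<otimes>\<^bsub>?P\<^esub> z = x \<otimes>\<^bsub>?P\<^esub> z \<oplus>\<^bsub>?P\<^esub> y \<otimes>\<^bsub>?P\<^esub> z" for x y z
    by (simp add: nc_poly_ring_mult frag_extend_add)
  show "z \<otimes>\<^bsub>?P\<^esub> (x \<oplus>\<^bsub>?P\<^esub> y) = z \<otimes>\<^bsub>?P\<^esub> x \<oplus>\<^bsub>?P\<^esub> z \<otimes>\<^bsub>?P\<^esub> y" for x y z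
    by (simp add: nc_poly_ring_mult frag_extend_add frag_extend_plus)
qed

lemma nc_poly_ring_finsum:
  assumes "finite I" "\<And>i. i \<in> I \<Longrightarrow> f i \<in> carrier (nc_poly_ring Y)"
  shows "(\<Oplus>\<^bsub>nc_poly_ring Y\<^esub>i\<in>I. f i) = (\<Sum>i\<in>I. f i)"
proof -
  interpret ring "nc_poly_ring Y" by (rule nc_poly_ring_ring)
  show ?thesis
    using assms
  proof (induction I)
    case (insert i I)
    then have "f \<in> I \<rightarrow> carrier (nc_poly_ring Y)" "f i \<in> carrier (nc_poly_ring Y)" by auto
    with insert show ?case by (subst finsum_insert) auto
  qed simp
qed

text \<open>The coefficient of a word in a decomposition can only come from the component of the degree of
  that word, so the components are the restrictions to the words of each degree.\<close>

lemma nc_poly_ring_graded: "graded_ring (nc_poly_ring Y)"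
proof -
  let ?P = "nc_poly_ring Y"
  interpret ring ?P by (rule nc_poly_ring_ring)
  define part where "part p i = frag_extend (\<lambda>w. if word_degree w = i then frag_of w else 0) p"
    for p :: "(int \<times> 'a) list \<Rightarrow>\<^sub>0 int" and i
  have lookup_part: "poly_mapping.lookup (part p i) w
      = (if word_degree w = i then poly_mapping.lookup p w else 0)" for p i w
    unfolding part_def using subset_UNIV[of "Poly_Mapping.keys p"]
    by (induction p rule: frag_induction) (auto simp: frag_extend_diff lookup_minus)
  show ?thesis
  proof (intro graded_ring.intro nc_poly_ring_ring graded_ring_axioms.intro)
    show "additive_subgroup (gr ?P i) ?P" for i
    proof (intro additive_subgroup.intro subgroup.intro)
      fix x assume "x \<in> gr ?P i"
      moreover from this have "inv\<^bsub>add_monoid ?P\<^esub> x = - x"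
        by (intro group.inv_equality[OF a_group]) (simp_all add: subset_iff)
      ultimately show "inv\<^bsub>add_monoid ?P\<^esub> x \<in> gr ?P i" by simp
    qed (auto simp: keys_plus_subset)
    show "\<one>\<^bsub>?P\<^esub> \<in> gr ?P 0" by (simp add: keys_frag_of)
    show "a \<otimes>\<^bsub>?P\<^esub> b \<in> gr ?P (i + j)" if "a \<in> gr ?P i" "b \<in> gr ?P j" for a b i j
      using that unfolding nc_poly_ring_mult nc_poly_ring_simps mem_Collect_eq
      by (elim keys_frag_extend_subset) (simp add: keys_frag_of)
    fix p assume p: "p \<in> carrier ?P"
    show "\<exists>!f. is_decomp ?P p f"
    proof (rule ex1I)
      have sub: "{i. part p i \<noteq> 0} \<subseteq> word_degree ` Poly_Mapping.keys p"
      proof clarify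
        fix i assume "part p i \<noteq> 0"
        then obtain w where "poly_mapping.lookup (part p i) w \<noteq> 0"
          by (metis lookup_zero poly_mapping_eqI)
        then show "i \<in> word_degree ` Poly_Mapping.keys p"
          by (auto simp: lookup_part in_keys_iff split: if_splits)
      qed
      then have fin: "finite {i. part p i \<noteq> 0}" by (rule finite_subset) simp
      have gr: "part p i \<in> gr ?P i" for i
        using p by (auto simp: in_keys_iff lookup_part split: if_splits)
      have "(\<Oplus>\<^bsub>?P\<^esub>i\<in>{i. part p i \<noteq> 0}. part p i) = (\<Sum>i\<in>{i. part p i \<noteq> 0}. part p i)"
        using gr by (intro nc_poly_ring_finsum[OF fin]) auto
      also have "\<dots> = p"
      proof (rule poly_mapping_eqI)
        fix w
        have "poly_mapping.lookup (\<Sum>i\<in>{i. part p i \<noteq> 0}. part p i) w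
            = (\<Sum>i\<in>{i. part p i \<noteq> 0}. if i = word_degree w then poly_mapping.lookup p w else 0)"
          by (auto simp: lookup_sum lookup_part intro: sum.cong)
        also have "\<dots> = poly_mapping.lookup p w"
          using fin lookup_part[of p "word_degree w" w] by auto
        finally show "poly_mapping.lookup (\<Sum>i\<in>{i. part p i \<noteq> 0}. part p i) w
            = poly_mapping.lookup p w" .
      qed
      finally show "is_decomp ?P p (part p)"
        using gr fin by (simp add: is_decomp_def)
    next
      fix f assume f: "is_decomp ?P p f"
      then have grf: "f i \<in> gr ?P i" and fin: "finite {i. f i \<noteq> 0}" for i
        by (auto simp: is_decomp_def)
      have p_eq: "p = (\<Sum>i\<in>{i. f i \<noteq> 0}. f i)"
        using f grf nc_poly_ring_finsum[OF fin, of f Y] by (auto simp: is_decomp_def)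
      have "poly_mapping.lookup (f i) w = poly_mapping.lookup (part p i) w" for i w
      proof -
        have zero: "poly_mapping.lookup (f j) w = 0" if "j \<noteq> word_degree w" for j
          using grf[of j] that by (auto simp: in_keys_iff)
        have "poly_mapping.lookup p w = (\<Sum>j\<in>{i. f i \<noteq> 0}. poly_mapping.lookup (f j) w)"
          by (subst p_eq) (simp add: lookup_sum)
        also have "\<dots> = (\<Sum>j\<in>{i. f i \<noteq> 0}. if j = word_degree w
            then poly_mapping.lookup (f (word_degree w)) w else 0)"
          by (rule sum.cong) (auto simp: zero)
        also have "\<dots> = poly_mapping.lookup (f (word_degree w)) w"
          using fin by auto
        finally show ?thesis by (auto simp: lookup_part zero)
      qed
      then show "f = part p" by (auto intro!: ext poly_mapping_eqI)
    qed
  qed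
qed

section \<open>The tensor product of graded rings\<close>

lemma tensor_pre_simps [simp]:
  "carrier (tensor_pre R S) = carrier (free_Abelian_group (carrier R \<times> carrier S))"
  "\<zero>\<^bsub>tensor_pre R S\<^esub> = 0"
  "\<one>\<^bsub>tensor_pre R S\<^esub> = frag_of (\<one>\<^bsub>R\<^esub>, \<one>\<^bsub>S\<^esub>)"
  "x \<oplus>\<^bsub>tensor_pre R S\<^esub> y = x + y"
  by (auto simp: tensor_pre_def)

lemma tensor_pre_mult:
  "x \<otimes>\<^bsub>tensor_pre R S\<^esub> y = frag_extend (\<lambda>p. frag_extend (\<lambda>q. tensor_gen_mult R S p q) y) x"
  by (simp add: tensor_pre_def)

lemma add_monoid_tensor_pre:
  "add_monoid (tensor_pre R S) = free_Abelian_group (carrier R \<times> carrier S)"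
  by (simp add: tensor_pre_def free_Abelian_group_def)

lemma tensor_pre_mult_add:
  "(x + x') \<otimes>\<^bsub>tensor_pre R S\<^esub> y = x \<otimes>\<^bsub>tensor_pre R S\<^esub> y + x' \<otimes>\<^bsub>tensor_pre R S\<^esub> y"
  "x \<otimes>\<^bsub>tensor_pre R S\<^esub> (y + y') = x \<otimes>\<^bsub>tensor_pre R S\<^esub> y + x \<otimes>\<^bsub>tensor_pre R S\<^esub> y'"
  by (simp_all add: tensor_pre_mult frag_extend_add frag_extend_plus)

lemma tensor_pre_mult_diff:
  "(x - x') \<otimes>\<^bsub>tensor_pre R S\<^esub> y = x \<otimes>\<^bsub>tensor_pre R S\<^esub> y - x' \<otimes>\<^bsub>tensor_pre R S\<^esub> y"
  "x \<otimes>\<^bsub>tensor_pre R S\<^esub> (y - y') = x \<otimes>\<^bsub>tensor_pre R S\<^esub> y - x \<otimes>\<^bsub>tensor_pre R S\<^esub> y'"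
  by (simp_all add: tensor_pre_mult frag_extend_diff frag_extend_minus_fun)

lemma tensor_pre_mult_zero [simp]:
  "0 \<otimes>\<^bsub>tensor_pre R S\<^esub> y = 0" "x \<otimes>\<^bsub>tensor_pre R S\<^esub> 0 = 0"
  by (simp_all add: tensor_pre_mult) (simp add: frag_extend_eq_0)

lemma tensor_pre_mult_frag_of [simp]:
  "frag_of p \<otimes>\<^bsub>tensor_pre R S\<^esub> frag_of q = tensor_gen_mult R S p q"
  by (simp add: tensor_pre_mult)

locale graded_ring_pair = R: graded_ring R + S: graded_ring S
  for R :: "('a, 'm) gring_scheme" and S :: "('b, 'n) gring_scheme"
begin

abbreviation "F \<equiv> free_Abelian_group (carrier R \<times> carrier S)"
abbreviation "I \<equiv> tensor_ideal R S"
abbreviation "T \<equiv> graded_tensor R S"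

lemma tensor_rels_subset: "tensor_rels R S \<subseteq> carrier F"
  by (auto simp: tensor_rels_def dest!: subsetD[OF keys_diff] simp: keys_frag_of)

lemma subgroup_tensor_ideal: "subgroup I F"
  unfolding tensor_ideal_def
  by (rule group.generate_is_subgroup[OF group_free_Abelian_group tensor_rels_subset])

lemma tensor_ideal_normal: "I \<lhd> F"
  using comm_group.subgroup_imp_normal[OF abelian_free_Abelian_group subgroup_tensor_ideal] .

lemma tensor_ideal_keys: "x \<in> I \<Longrightarrow> Poly_Mapping.keys x \<subseteq> carrier R \<times> carrier S"
  using subgroup.mem_carrier[OF subgroup_tensor_ideal] by simp

lemma tensor_ideal_zero [simp]: "0 \<in> I"
  using subgroup.one_closed[OF subgroup_tensor_ideal] by simp

lemma tensor_ideal_add: "\<lbrakk>x \<in> I; y \<in> I\<rbrakk> \<Longrightarrow> x + y \<in> I"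
  using subgroup.m_closed[OF subgroup_tensor_ideal] by simp

lemma tensor_ideal_minus: "x \<in> I \<Longrightarrow> - x \<in> I"
  using subgroup.m_inv_closed[OF subgroup_tensor_ideal, of x] tensor_ideal_keys[of x] by simp

lemma tensor_ideal_diff: "\<lbrakk>x \<in> I; y \<in> I\<rbrakk> \<Longrightarrow> x - y \<in> I"
  using tensor_ideal_add[OF _ tensor_ideal_minus] by fastforce

lemma tensor_ideal_sum: "(\<And>i. i \<in> J \<Longrightarrow> f i \<in> I) \<Longrightarrow> sum f J \<in> I"
  by (induction J rule: infinite_finite_induct) (auto intro: tensor_ideal_add)

lemma tensor_ideal_cmul: "x \<in> I \<Longrightarrow> frag_cmul c x \<in> I"
  by (rule frag_closure_minus_cmul) (auto intro: tensor_ideal_diff)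

lemma tensor_ideal_l_add:
  "\<lbrakk>a \<in> carrier R; a' \<in> carrier R; m \<in> carrier S\<rbrakk>
   \<Longrightarrow> frag_of (a \<oplus>\<^bsub>R\<^esub> a', m) - frag_of (a, m) - frag_of (a', m) \<in> I"
  unfolding tensor_ideal_def tensor_rels_def by (rule generate.incl) blast

lemma tensor_ideal_r_add:
  "\<lbrakk>a \<in> carrier R; m \<in> carrier S; m' \<in> carrier S\<rbrakk>
   \<Longrightarrow> frag_of (a, m \<oplus>\<^bsub>S\<^esub> m') - frag_of (a, m) - frag_of (a, m') \<in> I"
  unfolding tensor_ideal_def tensor_rels_def by (rule generate.incl) blast

lemma tensor_ideal_l_zero: "m \<in> carrier S \<Longrightarrow> frag_of (\<zero>\<^bsub>R\<^esub>, m) \<in> I"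
  using tensor_ideal_minus[OF tensor_ideal_l_add[of "\<zero>\<^bsub>R\<^esub>" "\<zero>\<^bsub>R\<^esub>" m]] by simp

lemma tensor_ideal_r_zero: "a \<in> carrier R \<Longrightarrow> frag_of (a, \<zero>\<^bsub>S\<^esub>) \<in> I"
  using tensor_ideal_minus[OF tensor_ideal_r_add[of a "\<zero>\<^bsub>S\<^esub>" "\<zero>\<^bsub>S\<^esub>"]] by simp

text \<open>A summand of \<open>tensor_gen_mult\<close>, for arbitrary degrees. Outside the two supports it is, up to sign,
  a generator with a zero entry, which is zero only modulo the relations.\<close>

definition signed_term :: "'a \<times> 'b \<Rightarrow> 'a \<times> 'b \<Rightarrow> int \<Rightarrow> int \<Rightarrow> ('a \<times> 'b \<Rightarrow>\<^sub>0 int)" where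
  "signed_term p q j k = frag_cmul (if even (j * k) then 1 else - 1)
     (frag_of (fst p \<otimes>\<^bsub>R\<^esub> hparts R (fst q) k, hparts S (snd p) j \<otimes>\<^bsub>S\<^esub> snd q))"

text \<open>The supports vary with the arguments and so stand in the way of additivity. Modulo the relations
  they may be replaced by common larger index sets.\<close>

lemma tensor_gen_mult_cong:
  assumes "p \<in> carrier R \<times> carrier S" "q \<in> carrier R \<times> carrier S"
    and fin: "finite J" "finite K" and sub: "hsupp S (snd p) \<subseteq> J" "hsupp R (fst q) \<subseteq> K"
  shows "(\<Sum>j\<in>J. \<Sum>k\<in>K. signed_term p q j k) - tensor_gen_mult R S p q \<in> I"
proof -
  let ?H = "hsupp S (snd p)" and ?L = "hsupp R (fst q)"
  have pq: "fst p \<in> carrier R" "snd p \<in> carrier S" "fst q \<in> carrier R" "snd q \<in> carrier S"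
    using assms by auto
  have outside: "signed_term p q j k \<in> I" if "j \<notin> ?H \<or> k \<notin> ?L" for j k
    using that pq by (auto simp: signed_term_def hsupp_def simp del: frag_cmul_minus_one
        intro!: tensor_ideal_cmul tensor_ideal_l_zero tensor_ideal_r_zero)
  have "(\<Sum>j\<in>J. \<Sum>k\<in>K. signed_term p q j k) - (\<Sum>j\<in>?H. \<Sum>k\<in>?L. signed_term p q j k)
     = (\<Sum>x\<in>J \<times> K - ?H \<times> ?L. signed_term p q (fst x) (snd x))"
    using fin sub by (subst sum_diff) (auto simp: sum.cartesian_product split_def)
  also have "\<dots> \<in> I"
  proof (rule tensor_ideal_sum)
    fix x assume "x \<in> J \<times> K - ?H \<times> ?L"
    then have "fst x \<notin> ?H \<or> snd x \<notin> ?L" by (cases x) auto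
    then show "signed_term p q (fst x) (snd x) \<in> I" by (rule outside)
  qed
  finally show ?thesis by (simp add: tensor_gen_mult_def signed_term_def)
qed

lemma signed_term_rel:
  assumes "a \<in> carrier R" "a' \<in> carrier R" "m \<in> carrier S" "m' \<in> carrier S"
    "q \<in> carrier R \<times> carrier S"
  shows "signed_term (a \<oplus>\<^bsub>R\<^esub> a', m) q j k - signed_term (a, m) q j k - signed_term (a', m) q j k \<in> I"
    "signed_term (a, m \<oplus>\<^bsub>S\<^esub> m') q j k - signed_term (a, m) q j k - signed_term (a, m') q j k \<in> I"
    "signed_term q (a \<oplus>\<^bsub>R\<^esub> a', m) j k - signed_term q (a, m) j k - signed_term q (a', m) j k \<in> I"
    "signed_term q (a, m \<oplus>\<^bsub>S\<^esub> m') j k - signed_term q (a, m) j k - signed_term q (a, m') j k \<in> I"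
proof -
  have cmul: "frag_cmul c x - frag_cmul c y - frag_cmul c z = frag_cmul c (x - y - z)"
    for c and x y z :: "'a \<times> 'b \<Rightarrow>\<^sub>0 int"
    by (rule poly_mapping_eqI) (simp add: lookup_minus right_diff_distrib)
  have q: "fst q \<in> carrier R" "snd q \<in> carrier S" using assms by auto
  show
    "signed_term (a \<oplus>\<^bsub>R\<^esub> a', m) q j k - signed_term (a, m) q j k - signed_term (a', m) q j k \<in> I"
    "signed_term (a, m \<oplus>\<^bsub>S\<^esub> m') q j k - signed_term (a, m) q j k - signed_term (a, m') q j k \<in> I"
    "signed_term q (a \<oplus>\<^bsub>R\<^esub> a', m) j k - signed_term q (a, m) j k - signed_term q (a', m) j k \<in> I"
    "signed_term q (a, m \<oplus>\<^bsub>S\<^esub> m') j k - signed_term q (a, m) j k - signed_term q (a, m') j k \<in> I"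
    unfolding signed_term_def cmul using assms q
    by (auto simp: R.l_distr R.r_distr S.l_distr S.r_distr R.hparts_add S.hparts_add
        simp del: frag_cmul_minus_one
        intro!: tensor_ideal_cmul tensor_ideal_l_add tensor_ideal_r_add)
qed

lemma tensor_gen_mult_rel:
  assumes p: "p \<in> carrier R \<times> carrier S" "p1 \<in> carrier R \<times> carrier S" "p2 \<in> carrier R \<times> carrier S"
    and q: "q \<in> carrier R \<times> carrier S"
  shows "(\<And>j k. signed_term p q j k - signed_term p1 q j k - signed_term p2 q j k \<in> I) \<Longrightarrow>
      tensor_gen_mult R S p q - tensor_gen_mult R S p1 q - tensor_gen_mult R S p2 q \<in> I"
    "(\<And>j k. signed_term q p j k - signed_term q p1 j k - signed_term q p2 j k \<in> I) \<Longrightarrow>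
      tensor_gen_mult R S q p - tensor_gen_mult R S q p1 - tensor_gen_mult R S q p2 \<in> I"
proof -
  let ?J = "hsupp S (snd p) \<union> hsupp S (snd p1) \<union> hsupp S (snd p2) \<union> hsupp S (snd q)"
  let ?K = "hsupp R (fst p) \<union> hsupp R (fst p1) \<union> hsupp R (fst p2) \<union> hsupp R (fst q)"
  have fin: "finite ?J" "finite ?K"
    using assms by (auto simp: mem_Times_iff R.finite_hsupp S.finite_hsupp)
  define s where "s x y = (\<Sum>j\<in>?J. \<Sum>k\<in>?K. signed_term x y j k)" for x y
  have s: "s x y - tensor_gen_mult R S x y \<in> I"
    if "x \<in> {p, p1, p2, q}" "y \<in> {p, p1, p2, q}" for x y
    unfolding s_def by (rule tensor_gen_mult_cong) (use fin that assms in auto)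
  have combine: "tensor_gen_mult R S x y - tensor_gen_mult R S x' y' - tensor_gen_mult R S x'' y'' \<in> I"
    if "{x, x', x'', y, y', y''} \<subseteq> {p, p1, p2, q}"
      and t: "\<And>j k. signed_term x y j k - signed_term x' y' j k - signed_term x'' y'' j k \<in> I"
    for x x' x'' y y' y''
  proof -
    have "s x y - s x' y' - s x'' y''
        = (\<Sum>j\<in>?J. \<Sum>k\<in>?K. signed_term x y j k - signed_term x' y' j k - signed_term x'' y'' j k)"
      by (simp add: s_def sum_subtractf)
    also have "\<dots> \<in> I" by (intro tensor_ideal_sum t)
    finally have "s x y - s x' y' - s x'' y'' \<in> I" .
    from tensor_ideal_diff[OF this tensor_ideal_diff[OF tensor_ideal_diff[OF s[of x y] s[of x' y']] s[of x'' y'']]]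
    show ?thesis using that(1) by (simp add: algebra_simps)
  qed
  show "(\<And>j k. signed_term p q j k - signed_term p1 q j k - signed_term p2 q j k \<in> I) \<Longrightarrow>
      tensor_gen_mult R S p q - tensor_gen_mult R S p1 q - tensor_gen_mult R S p2 q \<in> I"
    by (rule combine) auto
  show "(\<And>j k. signed_term q p j k - signed_term q p1 j k - signed_term q p2 j k \<in> I) \<Longrightarrow>
      tensor_gen_mult R S q p - tensor_gen_mult R S q p1 - tensor_gen_mult R S q p2 \<in> I"
    by (rule combine) auto
qed

lemma tensor_rels_mult:
  assumes x: "x \<in> tensor_rels R S" and q: "q \<in> carrier R \<times> carrier S"
  shows "x \<otimes>\<^bsub>tensor_pre R S\<^esub> frag_of q \<in> I" "frag_of q \<otimes>\<^bsub>tensor_pre R S\<^esub> x \<in> I"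
proof -
  obtain p p1 p2 where x_eq: "x = frag_of p - frag_of p1 - frag_of p2"
    and p: "p \<in> carrier R \<times> carrier S" "p1 \<in> carrier R \<times> carrier S" "p2 \<in> carrier R \<times> carrier S"
    and l: "\<And>j k. signed_term p q j k - signed_term p1 q j k - signed_term p2 q j k \<in> I"
    and r: "\<And>j k. signed_term q p j k - signed_term q p1 j k - signed_term q p2 j k \<in> I"
    using x q signed_term_rel unfolding tensor_rels_def
    by (elim UnE CollectE exE conjE) (metis (no_types, lifting) R.add.m_closed S.add.m_closed SigmaI)+
  show "x \<otimes>\<^bsub>tensor_pre R S\<^esub> frag_of q \<in> I" "frag_of q \<otimes>\<^bsub>tensor_pre R S\<^esub> x \<in> I"
    unfolding x_eq tensor_pre_mult_diff tensor_pre_mult_frag_of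
    using tensor_gen_mult_rel[OF p q] l r by auto
qed

text \<open>Multiplying a relation by a generator gives a signed sum of relations of the same kind; the rest
  is bilinearity.\<close>

lemma tensor_ideal_absorbs:
  assumes x: "x \<in> I" and y: "y \<in> carrier F"
  shows "x \<otimes>\<^bsub>tensor_pre R S\<^esub> y \<in> I \<and> y \<otimes>\<^bsub>tensor_pre R S\<^esub> x \<in> I"
proof -
  have rels: "r \<otimes>\<^bsub>tensor_pre R S\<^esub> y \<in> I \<and> y \<otimes>\<^bsub>tensor_pre R S\<^esub> r \<in> I"
    if r: "r \<in> tensor_rels R S" for r
    using y[unfolded carrier_free_Abelian_group_iff]
    by (rule free_Abelian_group_induct)
      (auto simp: tensor_pre_mult_diff tensor_rels_mult[OF r] intro: tensor_ideal_diff)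
  have rels_keys: "Poly_Mapping.keys r \<subseteq> carrier R \<times> carrier S" if "r \<in> tensor_rels R S" for r
    using subsetD[OF tensor_rels_subset that] by simp
  show ?thesis
    using x unfolding tensor_ideal_def
  proof (induction rule: generate.induct)
    case (inv h)
    then have "inv\<^bsub>F\<^esub> h = 0 - h" using rels_keys by simp
    then show ?case
      using rels[OF inv] tensor_ideal_diff[OF tensor_ideal_zero]
      by (simp only: tensor_pre_mult_diff tensor_pre_mult_zero) (auto simp: tensor_ideal_def)
  next
    case (eng h1 h2)
    then show ?case
      using tensor_ideal_add by (auto simp: tensor_pre_mult_add tensor_ideal_def)
  qed (use rels in \<open>auto simp: tensor_ideal_def[symmetric]\<close>)
qed

end

context graded_ring_pair
begin

lemma tensor_coset_eq: "I +>\<^bsub>tensor_pre R S\<^esub> z = (\<lambda>h. h + z) ` I"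
  by (auto simp: a_r_coset_def r_coset_def)

lemma tensor_coset_eqI:
  assumes "z - z' \<in> I"
  shows "I +>\<^bsub>tensor_pre R S\<^esub> z = I +>\<^bsub>tensor_pre R S\<^esub> z'"
proof -
  have *: "(\<lambda>h. h + x) ` I \<subseteq> (\<lambda>h. h + y) ` I" if "x - y \<in> I" for x y
  proof
    fix t assume "t \<in> (\<lambda>h. h + x) ` I"
    then obtain h where "h \<in> I" "t = h + x" by auto
    then have "t = (h + (x - y)) + y" "h + (x - y) \<in> I"
      using tensor_ideal_add that by auto
    then show "t \<in> (\<lambda>h. h + y) ` I" by blast
  qed
  show ?thesis
    unfolding tensor_coset_eq using *[OF assms] *[of z' z] tensor_ideal_minus[OF assms] by auto
qed

lemma tensor_coset_mult:
  assumes "x \<in> carrier F" "y \<in> carrier F"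
  shows "[mod I:] (I +>\<^bsub>tensor_pre R S\<^esub> x) \<Otimes>\<^bsub>tensor_pre R S\<^esub> (I +>\<^bsub>tensor_pre R S\<^esub> y)
    = I +>\<^bsub>tensor_pre R S\<^esub> (x \<otimes>\<^bsub>tensor_pre R S\<^esub> y)"
proof -
  have "I +>\<^bsub>tensor_pre R S\<^esub> (a \<otimes>\<^bsub>tensor_pre R S\<^esub> b)
      = I +>\<^bsub>tensor_pre R S\<^esub> (x \<otimes>\<^bsub>tensor_pre R S\<^esub> y)"
    if ab: "a \<in> I +>\<^bsub>tensor_pre R S\<^esub> x" "b \<in> I +>\<^bsub>tensor_pre R S\<^esub> y" for a b
  proof -
    obtain h k where hk: "h \<in> I" "a = h + x" "k \<in> I" "b = k + y"
      using ab by (auto simp: tensor_coset_eq)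
    then have "k + y \<in> carrier F"
      using assms tensor_ideal_keys[of k] by (simp add: keys_plus_subset)
    then have "h \<otimes>\<^bsub>tensor_pre R S\<^esub> (k + y) + x \<otimes>\<^bsub>tensor_pre R S\<^esub> k \<in> I"
      using tensor_ideal_absorbs hk assms by (intro tensor_ideal_add) auto
    then show ?thesis
      by (intro tensor_coset_eqI) (simp add: hk tensor_pre_mult_add algebra_simps)
  qed
  moreover have "x \<in> I +>\<^bsub>tensor_pre R S\<^esub> x" "y \<in> I +>\<^bsub>tensor_pre R S\<^esub> y"
    by (auto simp: tensor_coset_eq image_iff intro!: bexI[of _ 0])
  ultimately show ?thesis unfolding rcoset_mult_def by blast
qed

lemma tensor_add_monoid: "add_monoid (tensor_pre R S Quot I) = F Mod I"
  unfolding FactRing_def FactGroup_def A_RCOSETS_def set_add_def add_monoid_tensor_pre by simp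

lemma tensor_simps:
  "carrier T = carrier (F Mod I)"
  "x \<oplus>\<^bsub>T\<^esub> y = x \<otimes>\<^bsub>F Mod I\<^esub> y"
  "\<one>\<^bsub>T\<^esub> = pure_tensor R S \<one>\<^bsub>R\<^esub> \<one>\<^bsub>S\<^esub>"
  "x \<otimes>\<^bsub>T\<^esub> y = rcoset_mult (tensor_pre R S) I x y"
  "gr T l = generate (F Mod I)
     {pure_tensor R S a m | a m i j. a \<in> gr R i \<and> m \<in> gr S j \<and> i + j = l}"
  unfolding tensor_add_monoid[symmetric]
  by (simp_all add: graded_tensor_def ring.extend_def FactRing_def pure_tensor_def)

lemma pure_tensor_coset: "pure_tensor R S a m = I #>\<^bsub>F\<^esub> frag_of (a, m)"
  unfolding pure_tensor_def a_r_coset_def add_monoid_tensor_pre ..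

lemma pure_tensor_closed:
  "\<lbrakk>a \<in> carrier R; m \<in> carrier S\<rbrakk> \<Longrightarrow> pure_tensor R S a m \<in> carrier (F Mod I)"
  unfolding pure_tensor_coset FactGroup_def by (auto simp: RCOSETS_def keys_frag_of)

lemma pure_tensor_r_add:
  assumes "a \<in> carrier R" "m \<in> carrier S" "m' \<in> carrier S"
  shows "pure_tensor R S a (m \<oplus>\<^bsub>S\<^esub> m') = pure_tensor R S a m \<otimes>\<^bsub>F Mod I\<^esub> pure_tensor R S a m'"
proof -
  have "pure_tensor R S a (m \<oplus>\<^bsub>S\<^esub> m')
      = I +>\<^bsub>tensor_pre R S\<^esub> (frag_of (a, m) + frag_of (a, m'))"
    unfolding pure_tensor_def
    using tensor_ideal_r_add[OF assms] by (intro tensor_coset_eqI) (simp add: algebra_simps)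
  also have "\<dots> = pure_tensor R S a m \<otimes>\<^bsub>F Mod I\<^esub> pure_tensor R S a m'"
    using normal.rcos_sum[OF tensor_ideal_normal, of "frag_of (a, m)" "frag_of (a, m')"] assms
    unfolding pure_tensor_coset a_r_coset_def add_monoid_tensor_pre by (simp add: keys_frag_of)
  finally show ?thesis .
qed

text \<open>The sign is trivial in all the products that are needed to factor a pure tensor $a \otimes w$ into
  \<open>a\<close> and the letters of \<open>w\<close>.\<close>

lemma pure_tensor_mult:
  assumes "a \<in> carrier R" "m \<in> gr S j" "b \<in> gr R k" "n \<in> carrier S" "even (j * k)"
  shows "pure_tensor R S a m \<otimes>\<^bsub>T\<^esub> pure_tensor R S b n = pure_tensor R S (a \<otimes>\<^bsub>R\<^esub> b) (m \<otimes>\<^bsub>S\<^esub> n)"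
proof -
  have mb: "m \<in> carrier S" "b \<in> carrier R"
    using assms R.gr_closed S.gr_closed by auto
  have "signed_term (a, m) (b, n) j k - tensor_gen_mult R S (a, m) (b, n) \<in> I"
    using tensor_gen_mult_cong[of "(a, m)" "(b, n)" "{j}" "{k}"] assms mb
    by (simp add: R.hsupp_homogeneous S.hsupp_homogeneous)
  moreover have "signed_term (a, m) (b, n) j k = frag_of (a \<otimes>\<^bsub>R\<^esub> b, m \<otimes>\<^bsub>S\<^esub> n)"
    using assms by (simp add: signed_term_def R.hparts_homogeneous S.hparts_homogeneous)
  ultimately have "pure_tensor R S (a \<otimes>\<^bsub>R\<^esub> b) (m \<otimes>\<^bsub>S\<^esub> n)
      = I +>\<^bsub>tensor_pre R S\<^esub> tensor_gen_mult R S (a, m) (b, n)"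
    unfolding pure_tensor_def by (intro tensor_coset_eqI) simp
  then show ?thesis
    using tensor_coset_mult[of "frag_of (a, m)" "frag_of (b, n)"] assms mb
    by (simp add: tensor_simps(4) pure_tensor_def keys_frag_of)
qed

end

section \<open>Noncommutative semi-free graded rings\<close>

locale nc_semi_free_hom = A: graded_ring A + B: graded_ring B
  for A :: "('a, 'm) dgring_scheme" and B :: "('b, 'n) dgring_scheme" +
  fixes u :: "'a \<Rightarrow> 'b" and Y :: "(int \<times> 'x) set"
    and \<phi> :: "('a \<times> ((int \<times> 'x) list \<Rightarrow>\<^sub>0 int) \<Rightarrow>\<^sub>0 int) set \<Rightarrow> 'b"
  assumes u_hom: "u \<in> dg_hom A B"
    and letter_degree_nonpos: "y \<in> Y \<Longrightarrow> fst y \<le> 0"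
    and \<phi>_iso: "\<phi> \<in> ring_iso (graded_tensor A (nc_poly_ring Y)) B"
    and \<phi>_gr: "\<phi> ` gr (graded_tensor A (nc_poly_ring Y)) i = gr B i"
    and \<phi>_u: "a \<in> carrier A \<Longrightarrow> \<phi> (pure_tensor A (nc_poly_ring Y) a (frag_of [])) = u a"

sublocale nc_semi_free_hom \<subseteq> tensor: graded_ring_pair A "nc_poly_ring Y"
  by (intro graded_ring_pair.intro A.graded_ring_axioms nc_poly_ring_graded)

context nc_semi_free_hom
begin

abbreviation "P \<equiv> nc_poly_ring Y"

lemma u_closed [simp]: "a \<in> carrier A \<Longrightarrow> u a \<in> carrier B"
  using dg_homD(1)[OF u_hom] by (simp add: ring_hom_closed)

lemma u_gr: "a \<in> gr A i \<Longrightarrow> u a \<in> gr B i"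
  using dg_homD(2)[OF u_hom] .

lemma u_add: "\<lbrakk>a \<in> carrier A; b \<in> carrier A\<rbrakk> \<Longrightarrow> u (a \<oplus>\<^bsub>A\<^esub> b) = u a \<oplus>\<^bsub>B\<^esub> u b"
  using dg_homD(1)[OF u_hom] by (simp add: ring_hom_add)

lemma u_mult: "\<lbrakk>a \<in> carrier A; b \<in> carrier A\<rbrakk> \<Longrightarrow> u (a \<otimes>\<^bsub>A\<^esub> b) = u a \<otimes>\<^bsub>B\<^esub> u b"
  using dg_homD(1)[OF u_hom] by (simp add: ring_hom_mult)

lemma u_zero [simp]: "u \<zero>\<^bsub>A\<^esub> = \<zero>\<^bsub>B\<^esub>"
  using ring_hom_zero[OF dg_homD(1)[OF u_hom] A.ring_axioms B.ring_axioms] .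

lemma \<phi>_bij: "bij_betw \<phi> (carrier (tensor.F Mod tensor.I)) (carrier B)"
  using \<phi>_iso by (simp add: ring_iso_def tensor.tensor_simps)

lemma \<phi>_closed: "X \<in> carrier (tensor.F Mod tensor.I) \<Longrightarrow> \<phi> X \<in> carrier B"
  using \<phi>_bij bij_betwE by blast

lemma \<phi>_group_hom: "group_hom (tensor.F Mod tensor.I) (add_monoid B) \<phi>"
proof (intro group_hom.intro group_hom_axioms.intro)
  show "group (tensor.F Mod tensor.I)"
    using normal.factorgroup_is_group[OF tensor.tensor_ideal_normal] .
  show "group (add_monoid B)" by (rule B.a_group)
  show "\<phi> \<in> hom (tensor.F Mod tensor.I) (add_monoid B)"
    using \<phi>_iso \<phi>_closed
    by (auto simp: ring_iso_def ring_hom_def hom_def tensor.tensor_simps)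
qed

definition word :: "(int \<times> 'x) list \<Rightarrow> 'b" where
  "word w = \<phi> (pure_tensor A P \<one>\<^bsub>A\<^esub> (frag_of w))"

lemma frag_of_word_gr: "w \<in> lists Y \<Longrightarrow> frag_of w \<in> gr P (word_degree w)"
  by (simp add: keys_frag_of)

lemma frag_of_word_closed: "w \<in> lists Y \<Longrightarrow> frag_of w \<in> carrier P"
  by (simp add: keys_frag_of)

lemma \<phi>_mult:
  assumes "a \<in> carrier A" "m \<in> gr P j" "b \<in> gr A k" "n \<in> carrier P" "even (j * k)"
  shows "\<phi> (pure_tensor A P (a \<otimes>\<^bsub>A\<^esub> b) (m \<otimes>\<^bsub>P\<^esub> n))
    = \<phi> (pure_tensor A P a m) \<otimes>\<^bsub>B\<^esub> \<phi> (pure_tensor A P b n)"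
proof -
  have "b \<in> carrier A" "m \<in> carrier P"
    using assms A.gr_closed tensor.S.gr_closed by blast+
  then have "pure_tensor A P a m \<in> carrier tensor.T" "pure_tensor A P b n \<in> carrier tensor.T"
    using assms tensor.pure_tensor_closed unfolding tensor.tensor_simps(1) by blast+
  moreover have "\<phi> \<in> ring_hom tensor.T B" using \<phi>_iso by (simp add: ring_iso_def)
  ultimately show ?thesis
    using ring_hom_mult[of \<phi> tensor.T B] tensor.pure_tensor_mult[OF assms] by metis
qed

lemma \<phi>_pure_tensor_word:
  assumes "a \<in> carrier A" "w \<in> lists Y"
  shows "\<phi> (pure_tensor A P a (frag_of w)) = u a \<otimes>\<^bsub>B\<^esub> word w"
  using \<phi>_mult[of a "frag_of []" 0 "\<one>\<^bsub>A\<^esub>" 0 "frag_of w"] assms A.gr_one \<phi>_u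
    frag_of_word_gr[of "[]"] frag_of_word_closed[of w]
  by (simp add: word_def keys_frag_of)

lemma word_Nil [simp]: "word [] = \<one>\<^bsub>B\<^esub>"
  using \<phi>_u[of "\<one>\<^bsub>A\<^esub>"] ring_hom_one[OF dg_homD(1)[OF u_hom]] by (simp add: word_def)

lemma word_append:
  assumes "v \<in> lists Y" "w \<in> lists Y"
  shows "word (v @ w) = word v \<otimes>\<^bsub>B\<^esub> word w"
  using \<phi>_mult[of "\<one>\<^bsub>A\<^esub>" "frag_of v" "word_degree v" "\<one>\<^bsub>A\<^esub>" 0 "frag_of w"] assms A.gr_one
    frag_of_word_gr[of v] frag_of_word_closed[of w]
  by (simp add: word_def)

lemma word_gr:
  assumes "w \<in> lists Y" shows "word w \<in> gr B (word_degree w)"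
proof -
  have "pure_tensor A P \<one>\<^bsub>A\<^esub> (frag_of w) \<in> gr tensor.T (word_degree w)"
    unfolding tensor.tensor_simps
    using A.gr_one frag_of_word_gr[OF assms] by (intro generate.incl) force
  then show ?thesis unfolding word_def \<phi>_gr[symmetric] by (rule imageI)
qed

lemma word_closed [simp]: "w \<in> lists Y \<Longrightarrow> word w \<in> carrier B"
  using word_gr B.gr_closed by blast

text \<open>In each degree, \<open>B\<close> is additively spanned by the multiples of words. The zero element is such a
  multiple, so closure under differences is all that an induction has to check.\<close>

lemma gr_induct [consumes 1, case_names monomial minus]:
  assumes b: "b \<in> gr B l"
    and mon: "\<And>a i w. \<lbrakk>a \<in> gr A i; w \<in> lists Y; i + word_degree w = l\<rbrakk> \<Longrightarrow> Q (u a \<otimes>\<^bsub>B\<^esub> word w)"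
    and minus: "\<And>x y. \<lbrakk>x \<in> gr B l; y \<in> gr B l; Q x; Q y\<rbrakk> \<Longrightarrow> Q (x \<ominus>\<^bsub>B\<^esub> y)"
  shows "Q b"
proof -
  interpret \<phi>: group_hom "tensor.F Mod tensor.I" "add_monoid B" \<phi> by (rule \<phi>_group_hom)
  let ?Q = "\<lambda>x. x \<in> gr B l \<and> Q x"
  have Q_zero: "?Q \<zero>\<^bsub>B\<^esub>"
    using mon[of "\<zero>\<^bsub>A\<^esub>" l "[]"] by simp
  have Qminus: "?Q (x \<ominus>\<^bsub>B\<^esub> y)" if "?Q x" "?Q y" for x y
    using that minus B.gr_minus by blast
  have Qinv: "?Q (\<ominus>\<^bsub>B\<^esub> x)" if "?Q x" for x
    using Qminus[OF Q_zero that] B.gr_closed[of x l] that by (simp add: a_minus_def)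
  have Qadd: "?Q (x \<oplus>\<^bsub>B\<^esub> y)" if "?Q x" "?Q y" for x y
    using Qminus[OF that(1) Qinv[OF that(2)]] B.gr_closed[of y l] that by (simp add: a_minus_def)
  have pure: "?Q (\<phi> (pure_tensor A P a m))"
    if a: "a \<in> gr A i" and m: "m \<in> gr P j" and ij: "i + j = l" for a m i j
  proof -
    have ac: "a \<in> carrier A" using a A.gr_closed by blast
    have \<phi>_diff: "\<phi> (pure_tensor A P a (x - y)) = \<phi> (pure_tensor A P a x) \<ominus>\<^bsub>B\<^esub> \<phi> (pure_tensor A P a y)"
      if "x \<in> carrier P" "y \<in> carrier P" for x y
    proof -
      have xy: "x - y \<in> carrier P"
        using that keys_diff[of x y] by auto
      have "\<phi> (pure_tensor A P a ((x - y) \<oplus>\<^bsub>P\<^esub> y))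
          = \<phi> (pure_tensor A P a (x - y)) \<oplus>\<^bsub>B\<^esub> \<phi> (pure_tensor A P a y)"
        unfolding tensor.pure_tensor_r_add[OF ac xy that(2)]
        using \<phi>.hom_mult[OF tensor.pure_tensor_closed[OF ac xy] tensor.pure_tensor_closed[OF ac that(2)]]
        by simp
      then have "\<phi> (pure_tensor A P a x)
          = \<phi> (pure_tensor A P a (x - y)) \<oplus>\<^bsub>B\<^esub> \<phi> (pure_tensor A P a y)"
        by simp
      then show ?thesis
        using tensor.pure_tensor_closed ac xy that \<phi>_closed
        by (simp add: a_minus_def B.a_assoc B.r_neg)
    qed
    have "Poly_Mapping.keys m \<subseteq> {w \<in> lists Y. word_degree w = j}" using m by simp
    then show ?thesis
    proof (induction m rule: free_Abelian_group_induct[consumes 1, case_names zero diff generator])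
      case zero
      have "\<phi> (pure_tensor A P a (0 - 0)) = \<zero>\<^bsub>B\<^esub>"
        by (subst \<phi>_diff) (use ac tensor.pure_tensor_closed \<phi>_closed in \<open>auto simp: a_minus_def B.r_neg\<close>)
      then show ?case using Q_zero by simp
    next
      case (diff x y)
      then have "\<phi> (pure_tensor A P a (x - y))
          = \<phi> (pure_tensor A P a x) \<ominus>\<^bsub>B\<^esub> \<phi> (pure_tensor A P a y)"
        by (intro \<phi>_diff) auto
      with diff Qminus show ?case by simp
    next
      case (generator w)
      then show ?case
        using mon[OF a, of w] ij B.gr_mult[OF u_gr[OF a] word_gr[of w]]
        by (simp add: \<phi>_pure_tensor_word[OF ac])
    qed
  qed
  have gen: "X \<in> carrier (tensor.F Mod tensor.I) \<and> ?Q (\<phi> X)" if "X \<in> gr tensor.T l" for X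
    using that unfolding tensor.tensor_simps
  proof (induction rule: generate.induct)
    case one
    then show ?case using Q_zero \<phi>.hom_one \<phi>.G.one_closed by simp
  next
    case (incl X)
    then show ?case
      using pure tensor.pure_tensor_closed A.gr_closed tensor.S.gr_closed by blast
  next
    case (inv X)
    then have X: "X \<in> carrier (tensor.F Mod tensor.I)" "?Q (\<phi> X)"
      using pure tensor.pure_tensor_closed A.gr_closed tensor.S.gr_closed by blast+
    then show ?case
      using \<phi>.hom_inv[OF X(1)] \<phi>.G.inv_closed[OF X(1)] Qinv[OF X(2)] by (simp add: a_inv_def)
  next
    case (eng X X')
    then show ?case using \<phi>.hom_mult[of X X'] \<phi>.G.m_closed[of X X'] Qadd[of "\<phi> X" "\<phi> X'"] by simp
  qed
  obtain X where "X \<in> gr tensor.T l" "b = \<phi> X"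
    using b unfolding \<phi>_gr[symmetric] by auto
  with gen show ?thesis by blast
qed

text \<open>The words are independent over \<open>A\<close>. For fixed \<open>a\<close>, the values on words extend to the free abelian
  group of all polynomials; additivity in \<open>a\<close> then lets the universal property of the tensor product
  apply.\<close>

lemma additive_extension:
  fixes G :: "('c, 'k) monoid_scheme"
  assumes G: "comm_group G"
    and closed: "\<And>a w. \<lbrakk>a \<in> carrier A; w \<in> lists Y\<rbrakk> \<Longrightarrow> \<beta> a w \<in> carrier G"
    and add: "\<And>a a' w. \<lbrakk>a \<in> carrier A; a' \<in> carrier A; w \<in> lists Y\<rbrakk>
      \<Longrightarrow> \<beta> (a \<oplus>\<^bsub>A\<^esub> a') w = \<beta> a w \<otimes>\<^bsub>G\<^esub> \<beta> a' w"
  obtains h where "h \<in> hom (add_monoid B) G"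
    "\<And>a w. \<lbrakk>a \<in> carrier A; w \<in> lists Y\<rbrakk> \<Longrightarrow> h (u a \<otimes>\<^bsub>B\<^esub> word w) = \<beta> a w"
proof -
  interpret G: comm_group G by fact
  have "\<exists>k. k \<in> hom (free_Abelian_group (lists Y)) G \<and> (\<forall>w\<in>lists Y. k (frag_of w) = \<beta> a w)"
    if "a \<in> carrier A" for a
    by (rule G.free_Abelian_group_universal[of "\<beta> a" "lists Y"]) (use closed[OF that] in auto)
  then obtain k where k: "\<And>a. a \<in> carrier A \<Longrightarrow> k a \<in> hom (free_Abelian_group (lists Y)) G"
    "\<And>a w. \<lbrakk>a \<in> carrier A; w \<in> lists Y\<rbrakk> \<Longrightarrow> k a (frag_of w) = \<beta> a w"
    by metis
  have kP: "m \<in> carrier P \<longleftrightarrow> m \<in> carrier (free_Abelian_group (lists Y))" for m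
    by simp
  have k_closed: "k a m \<in> carrier G" if "a \<in> carrier A" "m \<in> carrier P" for a m
    using hom_in_carrier[OF k(1)] that kP by blast
  have k_add: "k a (m + m') = k a m \<otimes>\<^bsub>G\<^esub> k a m'"
    if "a \<in> carrier A" "m \<in> carrier P" "m' \<in> carrier P" for a m m'
    using hom_mult[OF k(1)[OF that(1)], of m m'] that by simp
  have k_diff: "k a (m - m') = k a m \<otimes>\<^bsub>G\<^esub> inv\<^bsub>G\<^esub> k a m'"
    if "a \<in> carrier A" "m \<in> carrier P" "m' \<in> carrier P" for a m m'
  proof -
    have "m - m' \<in> carrier P" using that keys_diff[of m m'] by auto
    with k_add[OF that(1) this that(3)] k_closed that show ?thesis
      by (simp add: G.m_assoc)
  qed
  have k_ladd: "k (a \<oplus>\<^bsub>A\<^esub> a') m = k a m \<otimes>\<^bsub>G\<^esub> k a' m"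
    if aa: "a \<in> carrier A" "a' \<in> carrier A" and m: "m \<in> carrier P" for a a' m
    using m unfolding nc_poly_ring_simps mem_Collect_eq
  proof (induction m rule: free_Abelian_group_induct[consumes 1, case_names zero diff generator])
    case zero
    have "k a 0 = \<one>\<^bsub>G\<^esub>" if "a \<in> carrier A" for a
      using k_diff[OF that, of 0 0] k_closed[OF that, of 0] by simp
    then show ?case using aa by simp
  next
    case (diff x y)
    then show ?case
      using aa k_closed by (simp add: k_diff G.inv_mult_group G.m_ac)
  next
    case (generator w)
    then show ?case using aa k(2) add by simp
  qed
  obtain H where H: "H \<in> hom tensor.F G"
    "\<And>p. p \<in> carrier A \<times> carrier P \<Longrightarrow> H (frag_of p) = k (fst p) (snd p)"
  proof (rule G.free_Abelian_group_universal[of "\<lambda>p. k (fst p) (snd p)" "carrier A \<times> carrier P"])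
    show "(\<lambda>p. k (fst p) (snd p)) ` (carrier A \<times> carrier P) \<subseteq> carrier G"
      using k_closed by auto
  qed auto
  interpret H: group_hom tensor.F G H
    by (intro group_hom.intro group_free_Abelian_group G.group_axioms group_hom_axioms.intro H(1))
  have H_diff: "H (x - y) = H x \<otimes>\<^bsub>G\<^esub> inv\<^bsub>G\<^esub> H y"
    if "x \<in> carrier tensor.F" "y \<in> carrier tensor.F" for x y
    using H.hom_mult[of x "- y"] H.hom_inv[of y] that by simp
  have F_diff: "x - y \<in> carrier tensor.F"
    if "x \<in> carrier tensor.F" "y \<in> carrier tensor.F" for x y
    using that keys_diff[of x y] by auto
  have P_add: "m + m' \<in> carrier P" if "m \<in> carrier P" "m' \<in> carrier P" for m m'
    using that by (simp add: keys_plus_subset)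
  have "x \<in> kernel tensor.F G H" if "x \<in> tensor_rels A P" for x
  proof -
    have rel: "frag_of p - frag_of p1 - frag_of p2 \<in> kernel tensor.F G H"
      if p: "p \<in> carrier A \<times> carrier P" "p1 \<in> carrier A \<times> carrier P" "p2 \<in> carrier A \<times> carrier P"
        and eq: "k (fst p) (snd p) = k (fst p1) (snd p1) \<otimes>\<^bsub>G\<^esub> k (fst p2) (snd p2)" for p p1 p2
    proof -
      have c: "k (fst p1) (snd p1) \<in> carrier G" "k (fst p2) (snd p2) \<in> carrier G"
        using p k_closed by auto
      have F: "frag_of p \<in> carrier tensor.F" "frag_of p1 \<in> carrier tensor.F"
        "frag_of p2 \<in> carrier tensor.F"
        using p by (auto simp only: frag_of_in_free_Abelian_group)
      have "H (frag_of p - frag_of p1 - frag_of p2) = \<one>\<^bsub>G\<^esub>"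
        using c p F F_diff by (simp only: H_diff H(2) eq) (simp add: G.m_comm[of _ "k (fst p2) (snd p2)"] G.m_assoc)
      then show ?thesis using F F_diff by (simp add: kernel_def)
    qed
    show ?thesis
      using that unfolding tensor_rels_def
      by (elim UnE CollectE exE conjE) (auto intro!: rel k_ladd k_add P_add simp del: nc_poly_ring_simps(1))
  qed
  then have "tensor.I \<subseteq> kernel tensor.F G H"
    unfolding tensor_ideal_def
    by (intro group.generate_subgroup_incl[OF group_free_Abelian_group _ H.subgroup_kernel]) auto
  from H.FactGroup_universal_kernel[OF tensor.tensor_ideal_normal this]
  obtain g where g: "g \<in> hom (tensor.F Mod tensor.I) G"
    "\<And>x. x \<in> carrier tensor.F \<Longrightarrow> g (tensor.I #>\<^bsub>tensor.F\<^esub> x) = H x"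
    by blast
  define \<psi> where "\<psi> = inv_into (carrier (tensor.F Mod tensor.I)) \<phi>"
  have "\<phi> \<in> iso (tensor.F Mod tensor.I) (add_monoid B)"
    using \<phi>_bij group_hom.homh[OF \<phi>_group_hom] by (simp add: iso_def)
  then have "\<psi> \<in> iso (add_monoid B) (tensor.F Mod tensor.I)"
    unfolding \<psi>_def
    by (intro group.iso_set_sym normal.factorgroup_is_group[OF tensor.tensor_ideal_normal])
  then have \<psi>: "\<psi> \<in> hom (add_monoid B) (tensor.F Mod tensor.I)" by (simp add: iso_def)
  show thesis
  proof (rule that)
    show "g \<circ> \<psi> \<in> hom (add_monoid B) G" using hom_compose[OF \<psi> g(1)] .
    fix a w assume aw: "a \<in> carrier A" "w \<in> lists Y"
    have "\<psi> (u a \<otimes>\<^bsub>B\<^esub> word w) = pure_tensor A P a (frag_of w)"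
      unfolding \<phi>_pure_tensor_word[OF aw, symmetric] \<psi>_def
      using \<phi>_bij tensor.pure_tensor_closed[OF aw(1) frag_of_word_closed[OF aw(2)]]
      by (intro inv_into_f_f) (auto simp: bij_betw_def)
    then have "(g \<circ> \<psi>) (u a \<otimes>\<^bsub>B\<^esub> word w) = g (tensor.I #>\<^bsub>tensor.F\<^esub> frag_of (a, frag_of w))"
      by (simp add: tensor.pure_tensor_coset)
    also have "\<dots> = k a (frag_of w)"
      using aw frag_of_word_closed[OF aw(2)] by (subst g(2)) (auto simp: H(2) keys_frag_of)
    finally show "(g \<circ> \<psi>) (u a \<otimes>\<^bsub>B\<^esub> word w) = \<beta> a w" using k(2)[OF aw] by simp
  qed
qed

end

section \<open>Derivations on a noncommutative semi-free DG ring\<close>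

text \<open>The situation in which a \<open>w\<^sub>0\<close>-\<open>w\<^sub>1\<close>-derivation can be \<open>A\<close>-linear: both homomorphisms restrict to
  the same central homomorphism \<open>t\<close> on \<open>A\<close>, and the derivation is 0 there.\<close>

locale semi_free_derivations = nc_semi_free_hom A B u Y \<phi> + Adg: dg_ring A + Bdg: dg_ring B + C: dg_ring C
  for A :: "('a, 'm) dgring_scheme" and B :: "('b, 'n) dgring_scheme"
    and u :: "'a \<Rightarrow> 'b" and Y :: "(int \<times> 'x) set" and \<phi>
    and C :: "('c, 'k) dgring_scheme" +
  fixes t :: "'a \<Rightarrow> 'c" and w\<^sub>0 w\<^sub>1 :: "'b \<Rightarrow> 'c"
  assumes A_nonpos: "nonpositive A"
    and u_center: "u ` carrier A \<subseteq> gcenter B"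
    and t_hom: "t \<in> dg_hom A C" and t_center: "t ` carrier A \<subseteq> gcenter C"
    and w\<^sub>0_hom: "w\<^sub>0 \<in> dg_hom B C" and w\<^sub>1_hom: "w\<^sub>1 \<in> dg_hom B C"
    and w\<^sub>0_u [simp]: "a \<in> carrier A \<Longrightarrow> w\<^sub>0 (u a) = t a"
    and w\<^sub>1_u [simp]: "a \<in> carrier A \<Longrightarrow> w\<^sub>1 (u a) = t a"
begin

sublocale w\<^sub>0: ring_hom_ring B C w\<^sub>0
  using dg_homD(1)[OF w\<^sub>0_hom] by (simp add: ring_hom_ringI2 B.ring_axioms C.ring_axioms)

sublocale w\<^sub>1: ring_hom_ring B C w\<^sub>1
  using dg_homD(1)[OF w\<^sub>1_hom] by (simp add: ring_hom_ringI2 B.ring_axioms C.ring_axioms)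

sublocale t: ring_hom_ring A C t
  using dg_homD(1)[OF t_hom] by (simp add: ring_hom_ringI2 A.ring_axioms C.ring_axioms)

lemma u_central:
  assumes "a \<in> gr A i" "b \<in> gr B j"
  shows "b \<otimes>\<^bsub>B\<^esub> u a = ksign B (i * j) (u a \<otimes>\<^bsub>B\<^esub> b)"
proof -
  have "u a \<otimes>\<^bsub>B\<^esub> b = ksign B (i * j) (b \<otimes>\<^bsub>B\<^esub> u a)"
    using B.gcenter_homogeneous[OF _ u_gr[OF assms(1)] assms(2)] u_center A.gr_closed[OF assms(1)]
    by blast
  then show ?thesis
    using B.gr_closed[OF assms(2)] A.gr_closed[OF assms(1)] by (simp add: B.ksign_ksign ksign_even)
qed

lemma t_central:
  assumes "a \<in> gr A i" "c \<in> gr C j"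
  shows "c \<otimes>\<^bsub>C\<^esub> t a = ksign C (i * j) (t a \<otimes>\<^bsub>C\<^esub> c)"
proof -
  have "t a \<otimes>\<^bsub>C\<^esub> c = ksign C (i * j) (c \<otimes>\<^bsub>C\<^esub> t a)"
    using C.gcenter_homogeneous[OF _ dg_homD(2)[OF t_hom assms(1)] assms(2)] t_center A.gr_closed[OF assms(1)]
    by blast
  then show ?thesis
    using C.gr_closed[OF assms(2)] A.gr_closed[OF assms(1)] by (simp add: C.ksign_ksign ksign_even)
qed

text \<open>The value on a word that the twisted Leibniz rule forces, given the values \<open>g\<close> on the letters.\<close>

fun word_der :: "(int \<times> 'x \<Rightarrow> 'c) \<Rightarrow> (int \<times> 'x) list \<Rightarrow> 'c" where
  "word_der g [] = \<zero>\<^bsub>C\<^esub>"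
| "word_der g (y # v) =
     g y \<otimes>\<^bsub>C\<^esub> w\<^sub>1 (word v) \<oplus>\<^bsub>C\<^esub> ksign C (fst y) (w\<^sub>0 (word [y]) \<otimes>\<^bsub>C\<^esub> word_der g v)"

definition letter_values :: "(int \<times> 'x \<Rightarrow> 'c) \<Rightarrow> bool" where
  "letter_values g \<longleftrightarrow> (\<forall>y\<in>Y. g y \<in> gr C (fst y - 1))"

text \<open>\<open>parity_involution\<close> supplies the sign that \<open>A\<close>-linearity in degree \<open>-1\<close> requires. On
  homogeneous elements, and hence on the carrier, the choice is unique because multiples of words
  span.\<close>

definition der :: "(int \<times> 'x \<Rightarrow> 'c) \<Rightarrow> 'b \<Rightarrow> 'c" where
  "der g = (SOME h. h \<in> hom (add_monoid B) (add_monoid C) \<and>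
     (\<forall>a\<in>carrier A. \<forall>v\<in>lists Y.
        h (u a \<otimes>\<^bsub>B\<^esub> word v) = C.parity_involution (t a) \<otimes>\<^bsub>C\<^esub> word_der g v))"

context
  fixes g assumes g: "letter_values g"
begin

lemma word_der_gr: "v \<in> lists Y \<Longrightarrow> word_der g v \<in> gr C (word_degree v - 1)"
proof (induction v)
  case (Cons y v)
  then have y: "y \<in> Y" and v: "v \<in> lists Y" by auto
  have "g y \<otimes>\<^bsub>C\<^esub> w\<^sub>1 (word v) \<in> gr C ((fst y - 1) + word_degree v)"
    using g y word_gr[OF v] by (intro C.gr_mult dg_homD(2)[OF w\<^sub>1_hom]) (auto simp: letter_values_def)
  moreover have "w\<^sub>0 (word [y]) \<otimes>\<^bsub>C\<^esub> word_der g v \<in> gr C (fst y + (word_degree v - 1))"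
    using Cons v y word_gr[of "[y]"] by (intro C.gr_mult dg_homD(2)[OF w\<^sub>0_hom]) auto
  ultimately show ?case by (simp add: C.gr_add C.gr_ksign algebra_simps)
qed simp

lemma word_der_closed [simp]: "v \<in> lists Y \<Longrightarrow> word_der g v \<in> carrier C"
  using word_der_gr C.gr_closed by blast

lemma word_der_append:
  assumes "v \<in> lists Y" "w \<in> lists Y"
  shows "word_der g (v @ w) = word_der g v \<otimes>\<^bsub>C\<^esub> w\<^sub>1 (word w)
    \<oplus>\<^bsub>C\<^esub> ksign C (word_degree v) (w\<^sub>0 (word v) \<otimes>\<^bsub>C\<^esub> word_der g w)"
  using assms(1)
proof (induction v)
  case Nil
  then show ?case using assms(2) by (simp add: ksign_even)
next
  case (Cons y v)
  then have y: "y \<in> Y" and v: "v \<in> lists Y" by auto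
  have gy: "g y \<in> carrier C" using g y C.gr_closed by (auto simp: letter_values_def)
  have "word (v @ w) = word v \<otimes>\<^bsub>B\<^esub> word w" "word (y # v) = word [y] \<otimes>\<^bsub>B\<^esub> word v"
    using word_append[OF v assms(2)] word_append[of "[y]" v] y v by auto
  with Cons.IH v y gy assms(2) show ?case
    by (simp add: C.ksign_add C.ksign_ksign C.ksign_l_mult C.ksign_r_mult C.l_distr C.r_distr
        C.m_assoc C.a_assoc)
qed

lemma der_spec:
  "der g \<in> hom (add_monoid B) (add_monoid C) \<and>
     (\<forall>a\<in>carrier A. \<forall>v\<in>lists Y.
        der g (u a \<otimes>\<^bsub>B\<^esub> word v) = C.parity_involution (t a) \<otimes>\<^bsub>C\<^esub> word_der g v)"
proof -
  obtain h where "h \<in> hom (add_monoid B) (add_monoid C)"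
    "\<And>a v. \<lbrakk>a \<in> carrier A; v \<in> lists Y\<rbrakk>
      \<Longrightarrow> h (u a \<otimes>\<^bsub>B\<^esub> word v) = C.parity_involution (t a) \<otimes>\<^bsub>C\<^esub> word_der g v"
    by (rule additive_extension[OF C.a_comm_group,
          of "\<lambda>a v. C.parity_involution (t a) \<otimes>\<^bsub>C\<^esub> word_der g v"])
      (auto simp: C.parity_involution_add C.l_distr simp del: in_lists_conv_set)
  then have "\<exists>h. h \<in> hom (add_monoid B) (add_monoid C) \<and> (\<forall>a\<in>carrier A. \<forall>v\<in>lists Y.
        h (u a \<otimes>\<^bsub>B\<^esub> word v) = C.parity_involution (t a) \<otimes>\<^bsub>C\<^esub> word_der g v)"
    by blast
  then show ?thesis unfolding der_def by (rule someI_ex)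
qed

lemma der_hom: "der g \<in> hom (add_monoid B) (add_monoid C)"
  using der_spec by blast

lemma der_closed [simp]: "x \<in> carrier B \<Longrightarrow> der g x \<in> carrier C"
  using der_hom by (auto simp: hom_def)

lemma der_add: "\<lbrakk>x \<in> carrier B; y \<in> carrier B\<rbrakk> \<Longrightarrow> der g (x \<oplus>\<^bsub>B\<^esub> y) = der g x \<oplus>\<^bsub>C\<^esub> der g y"
  using der_hom by (auto simp: hom_def)

lemma der_zero [simp]: "der g \<zero>\<^bsub>B\<^esub> = \<zero>\<^bsub>C\<^esub>"
  using der_add[of "\<zero>\<^bsub>B\<^esub>" "\<zero>\<^bsub>B\<^esub>"] der_closed[of "\<zero>\<^bsub>B\<^esub>"]
  by (metis B.l_zero B.zero_closed C.add.r_cancel_one)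

lemma der_a_inv: "x \<in> carrier B \<Longrightarrow> der g (\<ominus>\<^bsub>B\<^esub> x) = \<ominus>\<^bsub>C\<^esub> der g x"
  using der_add[of x "\<ominus>\<^bsub>B\<^esub> x"]
  by (metis B.a_inv_closed B.r_neg C.a_comm C.minus_equality der_closed der_zero)

lemma der_minus:
  "\<lbrakk>x \<in> carrier B; y \<in> carrier B\<rbrakk> \<Longrightarrow> der g (x \<ominus>\<^bsub>B\<^esub> y) = der g x \<ominus>\<^bsub>C\<^esub> der g y"
  by (simp add: a_minus_def der_add der_a_inv)

lemma der_ksign: "x \<in> carrier B \<Longrightarrow> der g (ksign B i x) = ksign C i (der g x)"
  by (simp add: ksign_def der_a_inv)

lemma der_monomial:
  assumes "a \<in> gr A i" "v \<in> lists Y"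
  shows "der g (u a \<otimes>\<^bsub>B\<^esub> word v) = ksign C i (t a \<otimes>\<^bsub>C\<^esub> word_der g v)"
proof -
  have "C.parity_involution (t a) = ksign C i (t a)"
    using dg_homD(2)[OF t_hom assms(1)] by (rule C.parity_involution_homogeneous)
  then show ?thesis
    using der_spec assms A.gr_closed[OF assms(1)] by (simp add: C.ksign_l_mult del: in_lists_conv_set)
qed

lemma der_word: "v \<in> lists Y \<Longrightarrow> der g (word v) = word_der g v"
  using der_monomial[OF A.gr_one, of v] ring_hom_one[OF dg_homD(1)[OF u_hom]]
  by (simp add: ksign_even)

lemma der_u:
  assumes "a \<in> carrier A" shows "der g (u a) = \<zero>\<^bsub>C\<^esub>"
  using der_spec assms by (auto dest!: bspec[of _ _ a] bspec[of _ _ "[]"])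

lemma der_gr: "b \<in> gr B l \<Longrightarrow> der g b \<in> gr C (l - 1)"
proof (induction rule: gr_induct)
  case (monomial a i v)
  have "t a \<otimes>\<^bsub>C\<^esub> word_der g v \<in> gr C (i + (word_degree v - 1))"
    using monomial word_der_gr by (intro C.gr_mult dg_homD(2)[OF t_hom])
  with monomial show ?case by (simp add: der_monomial C.gr_ksign add_diff_eq del: in_lists_conv_set)
next
  case (minus x y)
  then show ?case by (simp add: der_minus B.gr_closed C.gr_minus)
qed

lemma der_linear:
  assumes a: "a \<in> gr A i" and b: "b \<in> carrier B"
  shows "der g (u a \<otimes>\<^bsub>B\<^esub> b) = ksign C i (t a \<otimes>\<^bsub>C\<^esub> der g b)"
proof -
  have ac: "a \<in> carrier A" using a A.gr_closed by blast
  show ?thesis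
    using b
  proof (induction rule: B.graded_induct)
    case (homogeneous l b)
    then show ?case
    proof (induction rule: gr_induct)
      case (monomial a' i' v)
      have a': "a' \<in> carrier A" using monomial A.gr_closed by blast
      have "u a \<otimes>\<^bsub>B\<^esub> (u a' \<otimes>\<^bsub>B\<^esub> word v) = u (a \<otimes>\<^bsub>A\<^esub> a') \<otimes>\<^bsub>B\<^esub> word v"
        using ac a' monomial(2) by (simp add: u_mult B.m_assoc del: in_lists_conv_set)
      with monomial ac a' show ?case
        using A.gr_mult[OF a monomial(1)]
        by (simp add: der_monomial C.ksign_r_mult C.ksign_ksign C.m_assoc del: in_lists_conv_set)
    next
      case (minus x y)
      then have xy: "x \<in> carrier B" "y \<in> carrier B" by (auto intro: B.gr_closed)
      then have "u a \<otimes>\<^bsub>B\<^esub> (x \<ominus>\<^bsub>B\<^esub> y) = u a \<otimes>\<^bsub>B\<^esub> x \<ominus>\<^bsub>B\<^esub> u a \<otimes>\<^bsub>B\<^esub> y"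
        using ac by (simp add: a_minus_def B.r_distr B.r_minus)
      with minus xy ac show ?case
        by (simp add: der_minus) (simp add: ksign_def a_minus_def C.r_distr C.r_minus C.minus_add)
    qed
  next
    case (add x y)
    with ac show ?case by (simp add: B.r_distr der_add C.r_distr C.ksign_add)
  qed
qed

text \<open>A coefficient \<open>a\<close> of \<open>b\<close> has to be moved to the front, past \<open>word v\<close> in \<open>B\<close> and past \<open>word_der g v\<close>
  in \<open>C\<close>. The latter has one degree less; the factor $(-1)^{|a|}$ by which the two signs differ is the
  one in \<open>der_monomial\<close>.\<close>

lemma der_word_mult:
  assumes v: "v \<in> lists Y" and b: "b \<in> gr B l"
  shows "der g (word v \<otimes>\<^bsub>B\<^esub> b) = word_der g v \<otimes>\<^bsub>C\<^esub> w\<^sub>1 b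
    \<oplus>\<^bsub>C\<^esub> ksign C (word_degree v) (w\<^sub>0 (word v) \<otimes>\<^bsub>C\<^esub> der g b)"
  using b
proof (induction rule: gr_induct)
  case (monomial a i w)
  let ?d = "word_degree v" and ?T = "t a" and ?D = "word_der g v" and ?E = "word_der g w"
  let ?W0 = "w\<^sub>0 (word v)" and ?W1 = "w\<^sub>1 (word w)"
  have ac: "a \<in> carrier A" using monomial A.gr_closed by blast
  note c = ac v monomial(2) word_closed[OF v] word_closed[OF monomial(2)] word_der_closed[OF v]
    word_der_closed[OF monomial(2)]
  have vw: "v @ w \<in> lists Y" using v monomial(2) by simp
  have "word v \<otimes>\<^bsub>B\<^esub> (u a \<otimes>\<^bsub>B\<^esub> word w) = ksign B (i * ?d) (u a \<otimes>\<^bsub>B\<^esub> word (v @ w))"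
    using c u_central[OF monomial(1) word_gr[OF v]]
    by (simp add: B.m_assoc[symmetric] B.ksign_l_mult word_append del: in_lists_conv_set)
  then have "der g (word v \<otimes>\<^bsub>B\<^esub> (u a \<otimes>\<^bsub>B\<^esub> word w))
      = ksign C (i * ?d) (ksign C i (?T \<otimes>\<^bsub>C\<^esub> word_der g (v @ w)))"
    using vw ac monomial(1) by (simp add: der_ksign der_monomial del: in_lists_conv_set)
  also have "\<dots> = ksign C (i * ?d + i) (?T \<otimes>\<^bsub>C\<^esub> (?D \<otimes>\<^bsub>C\<^esub> ?W1))
      \<oplus>\<^bsub>C\<^esub> ksign C (i * ?d + i + ?d) (?T \<otimes>\<^bsub>C\<^esub> (?W0 \<otimes>\<^bsub>C\<^esub> ?E))"
    using c by (simp add: word_der_append C.r_distr C.ksign_add C.ksign_ksign C.ksign_r_mult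
        add.assoc del: in_lists_conv_set)
  also have "ksign C (i * ?d + i) (?T \<otimes>\<^bsub>C\<^esub> (?D \<otimes>\<^bsub>C\<^esub> ?W1)) = ?D \<otimes>\<^bsub>C\<^esub> (?T \<otimes>\<^bsub>C\<^esub> ?W1)"
  proof -
    have "?D \<otimes>\<^bsub>C\<^esub> (?T \<otimes>\<^bsub>C\<^esub> ?W1) = ksign C (i * (?d - 1)) (?T \<otimes>\<^bsub>C\<^esub> (?D \<otimes>\<^bsub>C\<^esub> ?W1))"
      using c t_central[OF monomial(1) word_der_gr[OF v]]
      by (simp add: C.m_assoc[symmetric] C.ksign_l_mult del: in_lists_conv_set)
    also have "\<dots> = ksign C (i * ?d + i) (?T \<otimes>\<^bsub>C\<^esub> (?D \<otimes>\<^bsub>C\<^esub> ?W1))"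
      by (rule ksign_parity) (simp add: algebra_simps)
    finally show ?thesis by simp
  qed
  also have "ksign C (i * ?d + i + ?d) (?T \<otimes>\<^bsub>C\<^esub> (?W0 \<otimes>\<^bsub>C\<^esub> ?E))
      = ksign C ?d (?W0 \<otimes>\<^bsub>C\<^esub> der g (u a \<otimes>\<^bsub>B\<^esub> word w))"
  proof -
    have "?W0 \<otimes>\<^bsub>C\<^esub> (?T \<otimes>\<^bsub>C\<^esub> ?E) = ksign C (i * ?d) (?T \<otimes>\<^bsub>C\<^esub> (?W0 \<otimes>\<^bsub>C\<^esub> ?E))"
      using c t_central[OF monomial(1) dg_homD(2)[OF w\<^sub>0_hom word_gr[OF v]]]
      by (simp add: C.m_assoc[symmetric] C.ksign_l_mult del: in_lists_conv_set)
    then show ?thesis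
      using c monomial(1)
      by (simp add: der_monomial C.ksign_r_mult C.ksign_ksign add_ac del: in_lists_conv_set)
  qed
  finally show ?case using c by (simp del: in_lists_conv_set)
next
  case (minus x y)
  then have xy: "x \<in> carrier B" "y \<in> carrier B" by (auto intro: B.gr_closed)
  note c = xy v word_closed[OF v] word_der_closed[OF v]
  have "word v \<otimes>\<^bsub>B\<^esub> (x \<ominus>\<^bsub>B\<^esub> y) = word v \<otimes>\<^bsub>B\<^esub> x \<ominus>\<^bsub>B\<^esub> word v \<otimes>\<^bsub>B\<^esub> y"
    using c by (simp add: a_minus_def B.r_distr B.r_minus)
  then have "der g (word v \<otimes>\<^bsub>B\<^esub> (x \<ominus>\<^bsub>B\<^esub> y)) =
    (word_der g v \<otimes>\<^bsub>C\<^esub> w\<^sub>1 x \<oplus>\<^bsub>C\<^esub> ksign C (word_degree v) (w\<^sub>0 (word v) \<otimes>\<^bsub>C\<^esub> der g x)) \<ominus>\<^bsub>C\<^esub>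
    (word_der g v \<otimes>\<^bsub>C\<^esub> w\<^sub>1 y \<oplus>\<^bsub>C\<^esub> ksign C (word_degree v) (w\<^sub>0 (word v) \<otimes>\<^bsub>C\<^esub> der g y))"
    using c minus by (simp add: der_minus del: in_lists_conv_set)
  with c show ?case
    by (cases "even (word_degree v)")
      (simp_all add: der_add der_a_inv a_minus_def ksign_def C.r_distr C.r_minus C.minus_add C.a_ac
        del: in_lists_conv_set)
qed

lemma der_leibniz:
  assumes b\<^sub>0: "b\<^sub>0 \<in> gr B k" and b\<^sub>1: "b\<^sub>1 \<in> gr B l"
  shows "der g (b\<^sub>0 \<otimes>\<^bsub>B\<^esub> b\<^sub>1) = der g b\<^sub>0 \<otimes>\<^bsub>C\<^esub> w\<^sub>1 b\<^sub>1 \<oplus>\<^bsub>C\<^esub> ksign C k (w\<^sub>0 b\<^sub>0 \<otimes>\<^bsub>C\<^esub> der g b\<^sub>1)"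
  using b\<^sub>0
proof (induction rule: gr_induct)
  case (monomial a i v)
  have ac: "a \<in> carrier A" using monomial A.gr_closed by blast
  note c = ac B.gr_closed[OF b\<^sub>1] monomial(2) word_closed[OF monomial(2)] word_der_closed[OF monomial(2)]
  have "der g ((u a \<otimes>\<^bsub>B\<^esub> word v) \<otimes>\<^bsub>B\<^esub> b\<^sub>1) = ksign C i (t a \<otimes>\<^bsub>C\<^esub> der g (word v \<otimes>\<^bsub>B\<^esub> b\<^sub>1))"
    using c der_linear[OF monomial(1), of "word v \<otimes>\<^bsub>B\<^esub> b\<^sub>1"]
    by (simp add: B.m_assoc del: in_lists_conv_set)
  with c monomial show ?case
    by (simp add: der_word_mult[OF _ b\<^sub>1] der_monomial C.ksign_add C.ksign_ksign C.ksign_l_mult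
        C.ksign_r_mult C.r_distr C.m_assoc del: in_lists_conv_set)
next
  case (minus x y)
  then have xy: "x \<in> carrier B" "y \<in> carrier B" by (auto intro: B.gr_closed)
  note c = xy B.gr_closed[OF b\<^sub>1]
  have "(x \<ominus>\<^bsub>B\<^esub> y) \<otimes>\<^bsub>B\<^esub> b\<^sub>1 = x \<otimes>\<^bsub>B\<^esub> b\<^sub>1 \<ominus>\<^bsub>B\<^esub> y \<otimes>\<^bsub>B\<^esub> b\<^sub>1"
    using c by (simp add: a_minus_def B.l_distr B.l_minus)
  then have "der g ((x \<ominus>\<^bsub>B\<^esub> y) \<otimes>\<^bsub>B\<^esub> b\<^sub>1) =
    (der g x \<otimes>\<^bsub>C\<^esub> w\<^sub>1 b\<^sub>1 \<oplus>\<^bsub>C\<^esub> ksign C k (w\<^sub>0 x \<otimes>\<^bsub>C\<^esub> der g b\<^sub>1)) \<ominus>\<^bsub>C\<^esub>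
    (der g y \<otimes>\<^bsub>C\<^esub> w\<^sub>1 b\<^sub>1 \<oplus>\<^bsub>C\<^esub> ksign C k (w\<^sub>0 y \<otimes>\<^bsub>C\<^esub> der g b\<^sub>1))"
    using c minus by (simp add: der_minus)
  with c show ?case
    by (cases "even k")
      (simp_all add: der_add der_a_inv a_minus_def ksign_def C.l_distr C.l_minus C.r_distr C.r_minus
        C.minus_add C.a_ac)
qed

lemma der_twisted_derivation: "twisted_derivation B C w\<^sub>0 w\<^sub>1 (der g)"
  unfolding twisted_derivation_def additive_map_deg_def
  using der_hom der_gr der_leibniz by auto

text \<open>The values of the derivation are sums of multiples of the values on letters, and the kernel of \<open>f\<close>
  is an ideal.\<close>

lemma der_in_kernel:
  assumes f: "f \<in> ring_hom C D" "ring D" and fg: "\<And>y. y \<in> Y \<Longrightarrow> f (g y) = \<zero>\<^bsub>D\<^esub>"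
    and b: "b \<in> carrier B"
  shows "f (der g b) = \<zero>\<^bsub>D\<^esub>"
proof -
  interpret f: ring_hom_ring C D f
    using f by (simp add: ring_hom_ringI2 C.ring_axioms)
  have word: "f (word_der g v) = \<zero>\<^bsub>D\<^esub>" if "v \<in> lists Y" for v
    using that
  proof (induction v)
    case (Cons y v)
    then have y: "y \<in> Y" and v: "v \<in> lists Y" by auto
    have "g y \<in> carrier C" using g y C.gr_closed by (auto simp: letter_values_def)
    with Cons.IH v y show ?case by (simp add: fg ring_hom_ksign[OF C.ring_axioms f(2,1)] ksign_def)
  qed simp
  show ?thesis
    using b
  proof (induction rule: B.graded_induct)
    case (homogeneous l b)
    then show ?case
    proof (induction rule: gr_induct)
      case (monomial a i v)
      then show ?case
        using word[OF monomial(2)] A.gr_closed[OF monomial(1)]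
        by (simp add: der_monomial ring_hom_ksign[OF C.ring_axioms f(2,1)] ksign_def
            del: in_lists_conv_set)
    qed (simp add: der_add der_a_inv B.gr_closed a_minus_def)
  qed (simp add: der_add)
qed

end

end

section \<open>Derivations that are homotopies\<close>

context semi_free_derivations
begin

text \<open>The homotopy identity at a single element, so that it can be established step by step.\<close>

definition contracts :: "(int \<times> 'x \<Rightarrow> 'c) \<Rightarrow> 'b \<Rightarrow> bool" where
  "contracts g b \<longleftrightarrow> dif C (der g b) \<oplus>\<^bsub>C\<^esub> der g (dif B b) = w\<^sub>1 b \<ominus>\<^bsub>C\<^esub> w\<^sub>0 b"

text \<open>The derivation vanishes on the image of \<open>A\<close>, where \<open>w\<^sub>0\<close> and \<open>w\<^sub>1\<close> agree.\<close>

lemma contracts_u: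
  assumes "letter_values g" "a \<in> carrier A"
  shows "contracts g (u a)"
proof -
  have "dif B (u a) = u (dif A a)"
    using dg_homD(3)[OF u_hom assms(2)] by simp
  then show ?thesis
    using assms by (simp add: contracts_def der_u a_minus_def C.r_neg)
qed

lemma contracts_add:
  assumes "letter_values g" "x \<in> carrier B" "y \<in> carrier B" "contracts g x" "contracts g y"
  shows "contracts g (x \<oplus>\<^bsub>B\<^esub> y)"
proof -
  have "dif C (der g (x \<oplus>\<^bsub>B\<^esub> y)) \<oplus>\<^bsub>C\<^esub> der g (dif B (x \<oplus>\<^bsub>B\<^esub> y)) =
    (dif C (der g x) \<oplus>\<^bsub>C\<^esub> der g (dif B x)) \<oplus>\<^bsub>C\<^esub> (dif C (der g y) \<oplus>\<^bsub>C\<^esub> der g (dif B y))"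
    using assms by (simp add: der_add Bdg.dif_add C.dif_add C.a_ac)
  also have "\<dots> = (w\<^sub>1 x \<ominus>\<^bsub>C\<^esub> w\<^sub>0 x) \<oplus>\<^bsub>C\<^esub> (w\<^sub>1 y \<ominus>\<^bsub>C\<^esub> w\<^sub>0 y)"
    using assms by (simp add: contracts_def)
  also have "\<dots> = w\<^sub>1 (x \<oplus>\<^bsub>B\<^esub> y) \<ominus>\<^bsub>C\<^esub> w\<^sub>0 (x \<oplus>\<^bsub>B\<^esub> y)"
    using assms by (simp add: a_minus_def C.minus_add C.a_ac)
  finally show ?thesis by (simp add: contracts_def)
qed

lemma contracts_minus:
  assumes "letter_values g" "x \<in> carrier B" "y \<in> carrier B" "contracts g x" "contracts g y"
  shows "contracts g (x \<ominus>\<^bsub>B\<^esub> y)"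
proof -
  have "dif C (der g (x \<ominus>\<^bsub>B\<^esub> y)) \<oplus>\<^bsub>C\<^esub> der g (dif B (x \<ominus>\<^bsub>B\<^esub> y)) =
    (dif C (der g x) \<oplus>\<^bsub>C\<^esub> der g (dif B x)) \<ominus>\<^bsub>C\<^esub> (dif C (der g y) \<oplus>\<^bsub>C\<^esub> der g (dif B y))"
    using assms by (simp add: der_add der_a_inv Bdg.dif_add Bdg.dif_a_inv C.dif_add C.dif_a_inv
        a_minus_def C.minus_add C.a_ac)
  also have "\<dots> = (w\<^sub>1 x \<ominus>\<^bsub>C\<^esub> w\<^sub>0 x) \<ominus>\<^bsub>C\<^esub> (w\<^sub>1 y \<ominus>\<^bsub>C\<^esub> w\<^sub>0 y)"
    using assms by (simp add: contracts_def)
  also have "\<dots> = w\<^sub>1 (x \<ominus>\<^bsub>B\<^esub> y) \<ominus>\<^bsub>C\<^esub> w\<^sub>0 (x \<ominus>\<^bsub>B\<^esub> y)"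
    using assms by (simp add: a_minus_def C.minus_add C.a_ac)
  finally show ?thesis by (simp add: contracts_def)
qed

text \<open>Both sides of the homotopy identity are \<open>w\<^sub>0\<close>-\<open>w\<^sub>1\<close>-derivations of degree 0, so the identity
  passes to products.\<close>

lemma contracts_mult:
  assumes g: "letter_values g" and x: "x \<in> gr B k" "contracts g x" and y: "y \<in> gr B l" "contracts g y"
  shows "contracts g (x \<otimes>\<^bsub>B\<^esub> y)"
proof -
  have c: "x \<in> carrier B" "y \<in> carrier B" using x y B.gr_closed by auto
  have c': "der g x \<in> carrier C" "der g y \<in> carrier C" "der g (dif B x) \<in> carrier C"
    "der g (dif B y) \<in> carrier C" "w\<^sub>0 x \<in> carrier C" "w\<^sub>0 y \<in> carrier C"
    "w\<^sub>1 x \<in> carrier C" "w\<^sub>1 y \<in> carrier C" "dif C (w\<^sub>0 x) \<in> carrier C" "dif C (w\<^sub>1 y) \<in> carrier C"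
    using c g by auto
  have dif_der: "dif C (der g b) = w\<^sub>1 b \<ominus>\<^bsub>C\<^esub> w\<^sub>0 b \<ominus>\<^bsub>C\<^esub> der g (dif B b)"
    if "contracts g b" "b \<in> carrier B" for b
  proof -
    have "dif C (der g b) = (dif C (der g b) \<oplus>\<^bsub>C\<^esub> der g (dif B b)) \<ominus>\<^bsub>C\<^esub> der g (dif B b)"
      using that g by (simp add: a_minus_def C.a_assoc C.r_neg)
    then show ?thesis using that(1) by (simp add: contracts_def)
  qed
  have 1: "dif C (der g (x \<otimes>\<^bsub>B\<^esub> y)) =
      (dif C (der g x) \<otimes>\<^bsub>C\<^esub> w\<^sub>1 y \<oplus>\<^bsub>C\<^esub> ksign C (k - 1) (der g x \<otimes>\<^bsub>C\<^esub> dif C (w\<^sub>1 y))) \<oplus>\<^bsub>C\<^esub>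
      ksign C k (dif C (w\<^sub>0 x) \<otimes>\<^bsub>C\<^esub> der g y \<oplus>\<^bsub>C\<^esub> ksign C k (w\<^sub>0 x \<otimes>\<^bsub>C\<^esub> dif C (der g y)))"
    using c c' der_leibniz[OF g x(1) y(1)]
      C.dif_leibniz[OF der_gr[OF g x(1)] dg_homD(2)[OF w\<^sub>1_hom y(1)]]
      C.dif_leibniz[OF dg_homD(2)[OF w\<^sub>0_hom x(1)] der_gr[OF g y(1)]]
    by (simp add: C.dif_add C.dif_ksign)
  have xy: "dif B x \<in> gr B (k + 1)" "dif B y \<in> gr B (l + 1)"
    using Bdg.dif_degree x y by auto
  have "der g (dif B (x \<otimes>\<^bsub>B\<^esub> y)) = der g (dif B x \<otimes>\<^bsub>B\<^esub> y) \<oplus>\<^bsub>C\<^esub> ksign C k (der g (x \<otimes>\<^bsub>B\<^esub> dif B y))"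
    using c g Bdg.dif_leibniz[OF x(1) y(1)] by (simp add: der_add der_ksign)
  then have 2: "der g (dif B (x \<otimes>\<^bsub>B\<^esub> y)) =
      (der g (dif B x) \<otimes>\<^bsub>C\<^esub> w\<^sub>1 y \<oplus>\<^bsub>C\<^esub> ksign C (k + 1) (dif C (w\<^sub>0 x) \<otimes>\<^bsub>C\<^esub> der g y)) \<oplus>\<^bsub>C\<^esub>
      ksign C k (der g x \<otimes>\<^bsub>C\<^esub> dif C (w\<^sub>1 y) \<oplus>\<^bsub>C\<^esub> ksign C k (w\<^sub>0 x \<otimes>\<^bsub>C\<^esub> der g (dif B y)))"
    using c der_leibniz[OF g xy(1) y(1)] der_leibniz[OF g x(1) xy(2)]
      dg_homD(3)[OF w\<^sub>0_hom, of x] dg_homD(3)[OF w\<^sub>1_hom, of y] by simp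
  have w: "w\<^sub>0 (x \<otimes>\<^bsub>B\<^esub> y) = w\<^sub>0 x \<otimes>\<^bsub>C\<^esub> w\<^sub>0 y" "w\<^sub>1 (x \<otimes>\<^bsub>B\<^esub> y) = w\<^sub>1 x \<otimes>\<^bsub>C\<^esub> w\<^sub>1 y"
    using c by auto
  \<comment> \<open>\<open>p\<close> and \<open>q\<close> are the terms with both a derivation and a differential; they cancel, and the parity
    of \<open>k\<close> only affects their signs.\<close>
  have alg: "((W1x \<ominus>\<^bsub>C\<^esub> W0x \<ominus>\<^bsub>C\<^esub> Dx) \<otimes>\<^bsub>C\<^esub> W1y \<oplus>\<^bsub>C\<^esub> p) \<oplus>\<^bsub>C\<^esub> (q \<oplus>\<^bsub>C\<^esub> W0x \<otimes>\<^bsub>C\<^esub> (W1y \<ominus>\<^bsub>C\<^esub> W0y \<ominus>\<^bsub>C\<^esub> Dy))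
      \<oplus>\<^bsub>C\<^esub> ((Dx \<otimes>\<^bsub>C\<^esub> W1y \<oplus>\<^bsub>C\<^esub> \<ominus>\<^bsub>C\<^esub> q) \<oplus>\<^bsub>C\<^esub> (\<ominus>\<^bsub>C\<^esub> p \<oplus>\<^bsub>C\<^esub> W0x \<otimes>\<^bsub>C\<^esub> Dy))
      = W1x \<otimes>\<^bsub>C\<^esub> W1y \<ominus>\<^bsub>C\<^esub> W0x \<otimes>\<^bsub>C\<^esub> W0y"
    if "W1x \<in> carrier C" "W0x \<in> carrier C" "W1y \<in> carrier C" "W0y \<in> carrier C"
      "Dx \<in> carrier C" "Dy \<in> carrier C" "p \<in> carrier C" "q \<in> carrier C"
    for W1x W0x W1y W0y Dx Dy p q
    using that by algebra
  show ?thesis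
  proof (cases "even k")
    case True
    show ?thesis
      unfolding contracts_def 1 2 w dif_der[OF x(2) c(1)] dif_der[OF y(2) c(2)]
      using True c'
        alg[of "w\<^sub>1 x" "w\<^sub>0 x" "w\<^sub>1 y" "w\<^sub>0 y" "der g (dif B x)" "der g (dif B y)"
          "\<ominus>\<^bsub>C\<^esub> (der g x \<otimes>\<^bsub>C\<^esub> dif C (w\<^sub>1 y))" "dif C (w\<^sub>0 x) \<otimes>\<^bsub>C\<^esub> der g y"]
      by (simp add: ksign_def)
  next
    case False
    show ?thesis
      unfolding contracts_def 1 2 w dif_der[OF x(2) c(1)] dif_der[OF y(2) c(2)]
      using False c'
        alg[of "w\<^sub>1 x" "w\<^sub>0 x" "w\<^sub>1 y" "w\<^sub>0 y" "der g (dif B x)" "der g (dif B y)"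
          "der g x \<otimes>\<^bsub>C\<^esub> dif C (w\<^sub>1 y)" "\<ominus>\<^bsub>C\<^esub> (dif C (w\<^sub>0 x) \<otimes>\<^bsub>C\<^esub> der g y)"]
      by (simp add: ksign_def C.minus_add)
  qed
qed

lemma letters_degree_ge: "\<lbrakk>v \<in> lists Y; y \<in> set v\<rbrakk> \<Longrightarrow> word_degree v \<le> fst y"
proof (induction v)
  case (Cons z v)
  then have "fst z \<le> 0" "v \<in> lists Y" using letter_degree_nonpos by auto
  moreover have "word_degree v \<le> 0"
    using \<open>v \<in> lists Y\<close> letter_degree_nonpos by (induction v) force+
  ultimately show ?case using Cons by auto
qed simp

text \<open>Since \<open>A\<close> and all letters have nonpositive degree, elements of degree at least \<open>n\<close> involve only
  letters of degree at least \<open>n\<close>.\<close>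

lemma gr_induct_ge [consumes 2, case_names monomial minus]:
  assumes "b \<in> gr B l" "n \<le> l"
    and mon: "\<And>a i v. \<lbrakk>a \<in> gr A i; v \<in> lists Y; \<And>y. y \<in> set v \<Longrightarrow> n \<le> fst y\<rbrakk> \<Longrightarrow> Q (u a \<otimes>\<^bsub>B\<^esub> word v)"
    and minus: "\<And>x y. \<lbrakk>x \<in> gr B l; y \<in> gr B l; Q x; Q y\<rbrakk> \<Longrightarrow> Q (x \<ominus>\<^bsub>B\<^esub> y)"
  shows "Q b"
  using assms(1)
proof (induction rule: gr_induct)
  case (monomial a i v)
  show ?case
  proof (cases "i \<le> 0")
    case True
    have "n \<le> fst y" if "y \<in> set v" for y
      using letters_degree_ge[OF monomial(2) that] True monomial(3) assms(2) by linarith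
    then show ?thesis by (rule mon[OF monomial(1,2)])
  next
    case False
    \<comment> \<open>Here \<open>a\<close> vanishes, and the empty word may take the place of \<open>v\<close>.\<close>
    with A_nonpos monomial(1) have "a = \<zero>\<^bsub>A\<^esub>" by (auto simp: nonpositive_def)
    with mon[of "\<zero>\<^bsub>A\<^esub>" 0 "[]"] monomial(2) show ?thesis by (simp del: in_lists_conv_set)
  qed
qed (rule minus)

lemma contracts_ge:
  assumes g: "letter_values g"
    and letters: "\<And>y. \<lbrakk>y \<in> Y; n \<le> fst y\<rbrakk> \<Longrightarrow> contracts g (word [y])"
    and b: "b \<in> gr B l" "n \<le> l"
  shows "contracts g b"
  using b
proof (induction rule: gr_induct_ge)
  case (monomial a i v)
  have "contracts g (word v)"
    using monomial(2,3)
  proof (induction v)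
    case Nil
    show ?case
      using contracts_u[OF g A.one_closed] ring_hom_one[OF dg_homD(1)[OF u_hom]] by simp
  next
    case (Cons y v)
    then have y: "y \<in> Y" "n \<le> fst y" and v: "v \<in> lists Y" by auto
    have "word (y # v) = word [y] \<otimes>\<^bsub>B\<^esub> word v"
      using word_append[of "[y]" v] y v by simp
    then show ?case
      using contracts_mult[OF g word_gr[of "[y]"] letters[OF y] word_gr[OF v]] Cons y v by simp
  qed
  then show ?case
    using contracts_mult[OF g u_gr[OF monomial(1)] contracts_u[OF g] word_gr[OF monomial(2)]]
      A.gr_closed[OF monomial(1)] by blast
next
  case (minus x y)
  then show ?case using contracts_minus[OF g] B.gr_closed by blast
qed

text \<open>Changing the values on letters of low degree does not disturb what is already settled in higher
  degrees.\<close>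

lemma der_cong_ge:
  assumes g: "letter_values g" "letter_values g'"
    and eq: "\<And>y. \<lbrakk>y \<in> Y; n \<le> fst y\<rbrakk> \<Longrightarrow> g y = g' y"
    and b: "b \<in> gr B l" "n \<le> l"
  shows "der g b = der g' b"
  using b
proof (induction rule: gr_induct_ge)
  case (monomial a i v)
  from monomial(2,3) have "word_der g v = word_der g' v"
    by (induction v) (auto simp: eq)
  with monomial g show ?case by (simp add: der_monomial del: in_lists_conv_set)
next
  case (minus x y)
  then show ?case using B.gr_closed by (simp add: der_minus g)
qed

lemma contracts_cong_ge:
  assumes g: "letter_values g" "letter_values g'"
    and eq: "\<And>y. \<lbrakk>y \<in> Y; n \<le> fst y\<rbrakk> \<Longrightarrow> g y = g' y"
    and b: "b \<in> gr B l" "n \<le> l"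
  shows "contracts g b \<longleftrightarrow> contracts g' b"
  using der_cong_ge[OF g eq b] der_cong_ge[OF g eq Bdg.dif_degree[OF b(1)]] b(2)
  by (simp add: contracts_def)

end

text \<open>Of a surjective quasi-isomorphism \<open>f\<close>, the construction of the homotopy uses that its kernel is
  acyclic.\<close>

locale semi_free_lifting = semi_free_derivations A B u Y \<phi> C t w\<^sub>0 w\<^sub>1 + D: dg_ring D
  for A :: "('a, 'm) dgring_scheme" and B :: "('b, 'n) dgring_scheme"
    and u :: "'a \<Rightarrow> 'b" and Y :: "(int \<times> 'x) set" and \<phi>
    and C :: "('c, 'k) dgring_scheme" and t :: "'a \<Rightarrow> 'c" and w\<^sub>0 w\<^sub>1 :: "'b \<Rightarrow> 'c"
    and D :: "('d, 'l) dgring_scheme" +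
  fixes f :: "'c \<Rightarrow> 'd"
  assumes f_hom: "f \<in> dg_hom C D"
    and f_w: "b \<in> carrier B \<Longrightarrow> f (w\<^sub>0 b) = f (w\<^sub>1 b)"
    and kernel_acyclic: "\<lbrakk>z \<in> gr C i; dif C z = \<zero>\<^bsub>C\<^esub>; f z = \<zero>\<^bsub>D\<^esub>\<rbrakk>
      \<Longrightarrow> \<exists>k\<in>gr C (i - 1). f k = \<zero>\<^bsub>D\<^esub> \<and> dif C k = z"
begin

sublocale f: ring_hom_ring C D f
  using dg_homD(1)[OF f_hom] by (simp add: ring_hom_ringI2 C.ring_axioms D.ring_axioms)

text \<open>The element that the differential of the value on \<open>y\<close> has to equal.\<close>

definition obstruction :: "(int \<times> 'x \<Rightarrow> 'c) \<Rightarrow> int \<times> 'x \<Rightarrow> 'c" where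
  "obstruction g y = w\<^sub>1 (word [y]) \<ominus>\<^bsub>C\<^esub> w\<^sub>0 (word [y]) \<ominus>\<^bsub>C\<^esub> der g (dif B (word [y]))"

definition kernel_valued :: "(int \<times> 'x \<Rightarrow> 'c) \<Rightarrow> bool" where
  "kernel_valued g \<longleftrightarrow> letter_values g \<and> (\<forall>y\<in>Y. f (g y) = \<zero>\<^bsub>D\<^esub>)"

definition primitive :: "(int \<times> 'x \<Rightarrow> 'c) \<Rightarrow> int \<times> 'x \<Rightarrow> 'c \<Rightarrow> bool" where
  "primitive g y k \<longleftrightarrow> k \<in> gr C (fst y - 1) \<and> f k = \<zero>\<^bsub>D\<^esub> \<and> dif C k = obstruction g y"

text \<open>The obstruction is a cocycle because the homotopy identity already holds at the differential of
  the letter, and it lies in the kernel, which is acyclic.\<close>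

lemma primitive_exists:
  assumes g: "kernel_valued g" and y: "y \<in> Y"
    and contr: "contracts g (dif B (word [y]))"
  shows "\<exists>k. primitive g y k"
proof -
  let ?x = "word [y]"
  have lv: "letter_values g" using g by (simp add: kernel_valued_def)
  have xg: "?x \<in> gr B (fst y)" using word_gr[of "[y]"] y by simp
  then have x: "?x \<in> carrier B" using B.gr_closed by blast
  have gr: "obstruction g y \<in> gr C (fst y)"
    unfolding obstruction_def
    using der_gr[OF lv Bdg.dif_degree[OF xg]]
    by (intro C.gr_minus dg_homD(2)[OF w\<^sub>0_hom xg] dg_homD(2)[OF w\<^sub>1_hom xg]) simp
  have "dif C (der g (dif B ?x)) = w\<^sub>1 (dif B ?x) \<ominus>\<^bsub>C\<^esub> w\<^sub>0 (dif B ?x)"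
    using contr x lv by (simp add: contracts_def Bdg.dif_dif)
  then have "dif C (obstruction g y) = \<zero>\<^bsub>C\<^esub>"
    using x lv dg_homD(3)[OF w\<^sub>0_hom x] dg_homD(3)[OF w\<^sub>1_hom x]
    by (simp add: obstruction_def C.dif_add C.dif_a_inv a_minus_def C.r_neg)
  moreover have "f (obstruction g y) = \<zero>\<^bsub>D\<^esub>"
    using der_in_kernel[OF lv f.homh D.ring_axioms, of "dif B ?x"] g x lv f_w[OF x]
    by (simp add: obstruction_def kernel_valued_def a_minus_def D.r_neg)
  ultimately show ?thesis
    using kernel_acyclic[OF gr] by (auto simp: primitive_def)
qed

text \<open>Letters of degree \<open>-n\<close> receive their values at stage \<open>Suc n\<close>, when the values in higher degrees
  are final. Until then they carry the value 0, which keeps the approximations total and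
  kernel-valued.\<close>

primrec approx :: "nat \<Rightarrow> int \<times> 'x \<Rightarrow> 'c" where
  "approx 0 = (\<lambda>_. \<zero>\<^bsub>C\<^esub>)"
| "approx (Suc n) = (\<lambda>y. if fst y = - int n then (SOME k. primitive (approx n) y k) else approx n y)"

lemma contracts_letter:
  assumes "letter_values g" "y \<in> Y" "dif C (g y) = obstruction g y"
  shows "contracts g (word [y])"
proof -
  have x: "word [y] \<in> carrier B" using assms(2) by simp
  have "g y \<in> carrier C" using assms C.gr_closed by (auto simp: letter_values_def)
  then have "der g (word [y]) = g y"
    using der_word[OF assms(1), of "[y]"] assms(2) by (simp add: ksign_def)
  then show ?thesis
    using x assms by (simp add: contracts_def obstruction_def a_minus_def C.a_assoc C.l_neg)
qed

lemma approx_contracts: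
  "kernel_valued (approx n) \<and> (\<forall>y\<in>Y. - int n < fst y \<longrightarrow> contracts (approx n) (word [y]))"
proof (induction n)
  case 0
  show ?case
    using letter_degree_nonpos by (fastforce simp: kernel_valued_def letter_values_def)
next
  case (Suc n)
  let ?g = "approx n" and ?g' = "approx (Suc n)"
  have g: "kernel_valued ?g" and lv: "letter_values ?g"
    using Suc by (auto simp: kernel_valued_def)
  have contr: "contracts ?g b" if "b \<in> gr B l" "- int n + 1 \<le> l" for b l
    by (rule contracts_ge[OF lv _ that]) (use Suc in auto)
  have new: "primitive ?g y (?g' y)" if "y \<in> Y" "fst y = - int n" for y
  proof -
    have "dif B (word [y]) \<in> gr B (fst y + 1)"
      using word_gr[of "[y]"] that by (intro Bdg.dif_degree) simp
    then have "\<exists>k. primitive ?g y k"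
      using that by (intro primitive_exists[OF g] contr[of _ "fst y + 1"]) auto
    then show ?thesis using that someI_ex[of "primitive ?g y"] by simp
  qed
  have old: "?g' y = ?g y" if "fst y \<noteq> - int n" for y using that by simp
  have g': "kernel_valued ?g'"
    unfolding kernel_valued_def letter_values_def
    using g new old by (metis kernel_valued_def letter_values_def primitive_def)
  then have lv': "letter_values ?g'" by (simp add: kernel_valued_def)
  have agree: "?g' y = ?g y" if "y \<in> Y" "- int n + 1 \<le> fst y" for y
    using that by (intro old) auto
  have "contracts ?g' (word [y])" if y: "y \<in> Y" "- int (Suc n) < fst y" for y
  proof (cases "fst y = - int n")
    case True
    have "dif B (word [y]) \<in> gr B (fst y + 1)"
      using word_gr[of "[y]"] y by (intro Bdg.dif_degree) simp
    then have "der ?g' (dif B (word [y])) = der ?g (dif B (word [y]))"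
      using True by (intro der_cong_ge[OF lv' lv agree]) auto
    then have "obstruction ?g' y = obstruction ?g y" by (simp add: obstruction_def)
    then show ?thesis
      using contracts_letter[OF lv' y(1)] new[OF y(1) True] by (simp add: primitive_def)
  next
    case False
    then have "- int n + 1 \<le> fst y" using y(2) by simp
    then show ?thesis
      using contracts_cong_ge[OF lv' lv agree word_gr[of "[y]"]] contr[OF word_gr[of "[y]"]] y(1)
      by simp
  qed
  with g' show ?case by blast
qed

definition limit :: "int \<times> 'x \<Rightarrow> 'c" where
  "limit y = approx (Suc (nat (- fst y))) y"

lemma approx_stable: "\<lbrakk>m \<le> n; - int m < fst y\<rbrakk> \<Longrightarrow> approx n y = approx m y"
  by (induction n rule: dec_induct) auto

lemma limit_kernel_valued: "kernel_valued limit"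
  using approx_contracts by (simp add: kernel_valued_def letter_values_def limit_def del: approx.simps)

lemma limit_contracts:
  assumes "b \<in> carrier B" shows "contracts limit b"
proof -
  have lv: "letter_values limit" "letter_values (approx n)" for n
    using limit_kernel_valued approx_contracts by (auto simp: kernel_valued_def)
  have letters: "contracts limit (word [y])" if y: "y \<in> Y" for y
  proof -
    let ?n = "Suc (nat (- fst y))"
    have "limit z = approx ?n z" if "fst y \<le> fst z" for z
      unfolding limit_def using that by (intro approx_stable[symmetric]) auto
    moreover have "contracts (approx ?n) (word [y])"
      using approx_contracts[of ?n] letter_degree_nonpos[OF y] y by (simp del: approx.simps)
    ultimately show ?thesis
      using contracts_cong_ge[OF lv(1) lv(2)[of ?n], of "fst y" "word [y]" "fst y"]
        word_gr[of "[y]"] y by simp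
  qed
  show ?thesis
    using assms
  proof (induction rule: B.graded_induct)
    case (homogeneous l x)
    then show ?case using contracts_ge[OF lv(1) letters, of l] by blast
  next
    case (add x y)
    then show ?case by (intro contracts_add[OF lv(1)])
  qed
qed

theorem homotopy_exists:
  "\<exists>\<gamma>. dg_ring_homotopy B C w\<^sub>0 w\<^sub>1 \<gamma> \<and> dg_linear A B u C t (- 1) \<gamma> \<and>
     (\<forall>b\<in>carrier B. f (\<gamma> b) = \<zero>\<^bsub>D\<^esub>)"
proof (intro exI conjI ballI)
  have lv: "letter_values limit" using limit_kernel_valued by (simp add: kernel_valued_def)
  show "dg_ring_homotopy B C w\<^sub>0 w\<^sub>1 (der limit)"
    using der_twisted_derivation[OF lv] limit_contracts
    by (simp add: dg_ring_homotopy_def contracts_def)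
  show "dg_linear A B u C t (- 1) (der limit)"
    unfolding dg_linear_def
  proof (intro conjI allI ballI)
    show "der limit \<in> additive_map_deg B C (- 1)"
      using der_twisted_derivation[OF lv] by (simp add: twisted_derivation_def)
    fix i a x assume "a \<in> gr A i" "x \<in> carrier B"
    then show "der limit (u a \<otimes>\<^bsub>B\<^esub> x) = ksign C (i * - 1) (t a \<otimes>\<^bsub>C\<^esub> der limit x)"
      using der_linear[OF lv] by (simp add: ksign_def)
  qed
  show "f (der limit b) = \<zero>\<^bsub>D\<^esub>" if "b \<in> carrier B" for b
    using limit_kernel_valued that
    by (intro der_in_kernel[OF lv f.homh D.ring_axioms]) (auto simp: kernel_valued_def)
qed

end

section \<open>Surjective quasi-isomorphisms have acyclic kernels\<close>

lemma coset_eq_image: "H +>\<^bsub>R\<^esub> x = (\<lambda>h. h \<oplus>\<^bsub>R\<^esub> x) ` H"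
  by (auto simp: a_r_coset_def r_coset_def)

lemma carrier_cohomology:
  "carrier (cohomology R i) = {coboundaries R i +>\<^bsub>R\<^esub> x | x. x \<in> cocycles R i}"
  by (auto simp: cohomology_def FactGroup_def RCOSETS_def a_r_coset_def r_coset_def)

context dg_ring
begin

lemma coboundary_closed: "h \<in> coboundaries R i \<Longrightarrow> h \<in> carrier R"
  using gr_closed by (auto simp: coboundaries_def)

lemma coboundary_zero: "\<zero> \<in> coboundaries R i"
  using gr_zero dif_zero unfolding coboundaries_def by (metis image_eqI)

lemma coboundary_add:
  assumes "x \<in> coboundaries R i" "y \<in> coboundaries R i"
  shows "x \<oplus> y \<in> coboundaries R i"
proof -
  obtain a b where ab: "a \<in> gr R (i - 1)" "x = dif R a" "b \<in> gr R (i - 1)" "y = dif R b"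
    using assms by (auto simp: coboundaries_def)
  then have "x \<oplus> y = dif R (a \<oplus> b)" using gr_closed by (simp add: dif_add)
  then show ?thesis using ab gr_add by (auto simp: coboundaries_def)
qed

end

lemma cohomology_map_coset:
  assumes "dg_ring R" "dg_ring S" "f \<in> dg_hom R S" "x \<in> carrier R"
  shows "cohomology_map S f i (coboundaries R i +>\<^bsub>R\<^esub> x) = coboundaries S i +>\<^bsub>S\<^esub> f x"
proof -
  interpret R: dg_ring R by fact
  interpret S: dg_ring S by fact
  interpret f: ring_hom_ring R S f
    using assms by (simp add: ring_hom_ringI2 R.ring_axioms S.ring_axioms dg_homD)
  have f_cob: "f h \<in> coboundaries S i" if "h \<in> coboundaries R i" for h
  proof -
    obtain a where a: "a \<in> gr R (i - 1)" "h = dif R a"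
      using \<open>h \<in> coboundaries R i\<close> by (auto simp: coboundaries_def)
    then have "f h = dif S (f a)" "f a \<in> gr S (i - 1)"
      using dg_homD(2,3)[OF assms(3)] R.gr_closed by auto
    then show ?thesis by (auto simp: coboundaries_def)
  qed
  have "h' \<oplus>\<^bsub>S\<^esub> f (h \<oplus>\<^bsub>R\<^esub> x) = (h' \<oplus>\<^bsub>S\<^esub> f h) \<oplus>\<^bsub>S\<^esub> f x"
    if "h \<in> coboundaries R i" "h' \<in> coboundaries S i" for h h'
    using that assms(4) R.coboundary_closed S.coboundary_closed by (simp add: S.a_assoc)
  then have "cohomology_map S f i (coboundaries R i +>\<^bsub>R\<^esub> x) \<subseteq> coboundaries S i +>\<^bsub>S\<^esub> f x"
    using f_cob S.coboundary_add by (auto simp: cohomology_map_def coset_eq_image)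
  moreover have "x \<in> coboundaries R i +>\<^bsub>R\<^esub> x"
    using R.coboundary_zero assms(4) by (force simp: coset_eq_image)
  ultimately show ?thesis unfolding cohomology_map_def by blast
qed

lemma surjective_degreewise:
  assumes "graded_ring R" "graded_ring S" "f \<in> dg_hom R S" "f ` carrier R = carrier S" "y \<in> gr S i"
  obtains x where "x \<in> gr R i" "f x = y"
proof -
  interpret R: graded_ring R by fact
  interpret S: graded_ring S by fact
  have "y \<in> f ` carrier R" using S.gr_closed[OF assms(5)] assms(4) by simp
  then obtain x where x: "x \<in> carrier R" "f x = y" by auto
  have "f (hparts R x i) = y"
    using dg_hom_hparts[OF assms(1-3) x(1), of i] S.hparts_homogeneous[OF assms(5)] x(2) by simp
  with R.hparts_gr[OF x(1)] that show thesis by blast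
qed

text \<open>A cocycle \<open>z\<close> of the kernel is the differential of some \<open>y\<close> by injectivity in cohomology, and \<open>f y\<close> is then a
  cocycle. By surjectivity in cohomology and in each degree, \<open>y\<close> can be corrected by a cocycle and a
  coboundary so that its image vanishes; this does not change its differential.\<close>

lemma kernel_acyclic:
  assumes R: "dg_ring R" and S: "dg_ring S" and qi: "quasi_iso R S f"
    and surj: "f ` carrier R = carrier S"
    and z: "z \<in> gr R i" "dif R z = \<zero>\<^bsub>R\<^esub>" "f z = \<zero>\<^bsub>S\<^esub>"
  shows "\<exists>k\<in>gr R (i - 1). f k = \<zero>\<^bsub>S\<^esub> \<and> dif R k = z"
proof -
  interpret R: dg_ring R by fact
  interpret S: dg_ring S by fact
  have f: "f \<in> dg_hom R S" and bij: "\<And>i. bij_betw (cohomology_map S f i)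
      (carrier (cohomology R i)) (carrier (cohomology S i))"
    using qi by (auto simp: quasi_iso_def iso_def)
  interpret f: ring_hom_ring R S f
    using f by (simp add: ring_hom_ringI2 R.ring_axioms S.ring_axioms dg_homD)
  note map = cohomology_map_coset[OF R S f]
  have zc: "z \<in> carrier R" using z R.gr_closed by blast
  have "coboundaries R i +>\<^bsub>R\<^esub> z = coboundaries R i +>\<^bsub>R\<^esub> \<zero>\<^bsub>R\<^esub>"
  proof (rule inj_onD[OF bij_betw_imp_inj_on[OF bij[of i]]])
    show "cohomology_map S f i (coboundaries R i +>\<^bsub>R\<^esub> z)
        = cohomology_map S f i (coboundaries R i +>\<^bsub>R\<^esub> \<zero>\<^bsub>R\<^esub>)"
      using z(3) zc by (simp add: map)
  qed (use z in \<open>auto simp: carrier_cohomology cocycles_def\<close>)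
  moreover have "z \<in> coboundaries R i +>\<^bsub>R\<^esub> z"
    using R.coboundary_zero zc by (force simp: coset_eq_image)
  ultimately obtain y where y: "y \<in> gr R (i - 1)" "z = dif R y"
    using R.gr_closed by (force simp: coset_eq_image coboundaries_def)
  have yc: "y \<in> carrier R" using y R.gr_closed by blast
  have fy: "f y \<in> cocycles S (i - 1)"
    using dg_homD(2)[OF f y(1)] dg_homD(3)[OF f yc] y(2) z(3) by (simp add: cocycles_def)
  then have "coboundaries S (i - 1) +>\<^bsub>S\<^esub> f y \<in> cohomology_map S f (i - 1) ` carrier (cohomology R (i - 1))"
    using bij_betw_imp_surj_on[OF bij[of "i - 1"]] by (auto simp: carrier_cohomology)
  then obtain x where x: "x \<in> cocycles R (i - 1)"
    "coboundaries S (i - 1) +>\<^bsub>S\<^esub> f y = coboundaries S (i - 1) +>\<^bsub>S\<^esub> f x"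
  proof -
    assume *: "\<And>x. \<lbrakk>x \<in> cocycles R (i - 1); coboundaries S (i - 1) +>\<^bsub>S\<^esub> f y
      = coboundaries S (i - 1) +>\<^bsub>S\<^esub> f x\<rbrakk> \<Longrightarrow> thesis"
    obtain x where x: "x \<in> cocycles R (i - 1)" "coboundaries S (i - 1) +>\<^bsub>S\<^esub> f y
        = cohomology_map S f (i - 1) (coboundaries R (i - 1) +>\<^bsub>R\<^esub> x)"
      using \<open>_ \<in> cohomology_map S f (i - 1) ` _\<close> by (auto simp: carrier_cohomology)
    moreover from x(1) have "x \<in> carrier R" using R.gr_closed by (auto simp: cocycles_def)
    ultimately show thesis using * map by simp
  qed
  have "f y \<in> coboundaries S (i - 1) +>\<^bsub>S\<^esub> f y"
    using S.coboundary_zero yc by (force simp: coset_eq_image)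
  then obtain b where b: "b \<in> gr S (i - 1 - 1)" "f y = dif S b \<oplus>\<^bsub>S\<^esub> f x"
    unfolding x(2) by (auto simp: coset_eq_image coboundaries_def)
  obtain a where a: "a \<in> gr R (i - 1 - 1)" "f a = b"
    using surjective_degreewise[OF R.graded_ring_axioms S.graded_ring_axioms f surj b(1)] .
  have xg: "x \<in> gr R (i - 1)" "dif R x = \<zero>\<^bsub>R\<^esub>" using x by (auto simp: cocycles_def)
  have c: "x \<in> carrier R" "a \<in> carrier R" using xg a R.gr_closed by auto
  let ?k = "y \<ominus>\<^bsub>R\<^esub> (dif R a \<oplus>\<^bsub>R\<^esub> x)"
  have "?k \<in> gr R (i - 1)"
    using y(1) xg(1) R.dif_degree[OF a(1)] by (intro R.gr_minus R.gr_add) auto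
  moreover have "f ?k = \<zero>\<^bsub>S\<^esub>"
    using c yc b(2) a(2) S.gr_closed[OF b(1)] dg_homD(3)[OF f c(2)] by (simp add: a_minus_def S.r_neg)
  moreover have "dif R ?k = z"
    using c yc xg(2) y(2) by (simp add: R.dif_add R.dif_a_inv R.dif_dif a_minus_def)
  ultimately show ?thesis by blast
qed

section \<open>Homotopy uniqueness of lifts\<close>

theorem theorem4p3:
  fixes A :: "('a, 'm) dgring_scheme"
    and B :: "('b, 'n) dgring_scheme"
    and Bt :: "('c, 'k) dgring_scheme"
    and Bt' :: "('d, 'l) dgring_scheme"
    and u :: "'a \<Rightarrow> 'b" and ut :: "'a \<Rightarrow> 'c" and ut' :: "'a \<Rightarrow> 'd"
    and v :: "'c \<Rightarrow> 'b" and v' :: "'d \<Rightarrow> 'b"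
    and w\<^sub>0 w\<^sub>1 :: "'d \<Rightarrow> 'c"
  assumes "comm_dg_ring A"
    and "nonpos_central_dg_ring A B u"
    and "nonpos_central_dg_ring A Bt ut"
    and "nonpos_central_dg_ring A Bt' ut'"
    and "v \<in> central_dg_mor A Bt ut B u"
    and "v' \<in> central_dg_mor A Bt' ut' B u"
    and "v ` carrier Bt = carrier B" and "quasi_iso Bt B v"
    and "nc_semi_free TYPE('x) A Bt' ut'"
    and "w\<^sub>0 \<in> dg_hom Bt' Bt" and "w\<^sub>1 \<in> dg_hom Bt' Bt"
    and "\<And>a. a \<in> carrier A \<Longrightarrow> w\<^sub>0 (ut' a) = ut a"
    and "\<And>a. a \<in> carrier A \<Longrightarrow> w\<^sub>1 (ut' a) = ut a"
    and "\<And>b. b \<in> carrier Bt' \<Longrightarrow> v (w\<^sub>0 b) = v' b"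
    and "\<And>b. b \<in> carrier Bt' \<Longrightarrow> v (w\<^sub>1 b) = v' b"
  shows "\<exists>\<gamma>. dg_ring_homotopy Bt' Bt w\<^sub>0 w\<^sub>1 \<gamma> \<and>
             dg_linear A Bt' ut' Bt ut (- 1) \<gamma> \<and>
             (\<forall>b\<in>carrier Bt'. v (\<gamma> b) = \<zero>\<^bsub>B\<^esub>)"
proof -
  have B: "dg_ring B" and Bt: "dg_ring Bt" and Bt': "dg_ring Bt'"
    and ut: "ut \<in> central_hom A Bt" and ut': "ut' \<in> central_hom A Bt'"
    using assms(2-4) by (auto simp: nonpos_central_dg_ring_def)
  interpret A: comm_dg_ring A by fact
  obtain X :: "int \<Rightarrow> 'x set" and \<phi> where \<phi>:
    "\<phi> \<in> ring_iso (graded_tensor A (nc_poly_ring (nonpos_coprod X))) Bt'"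
    "\<And>i. \<phi> ` gr (graded_tensor A (nc_poly_ring (nonpos_coprod X))) i = gr Bt' i"
    "\<And>a. a \<in> carrier A \<Longrightarrow> \<phi> (pure_tensor A (nc_poly_ring (nonpos_coprod X)) a (frag_of [])) = ut' a"
    using assms(9) by (auto simp: nc_semi_free_def Let_def)
  have v: "v \<in> dg_hom Bt B" using assms(5) by (simp add: central_dg_mor_def)
  interpret semi_free_lifting A Bt' ut' "nonpos_coprod X" \<phi> Bt ut w\<^sub>0 w\<^sub>1 B v
  proof (intro semi_free_lifting.intro semi_free_derivations.intro nc_semi_free_hom.intro
      nc_semi_free_hom_axioms.intro semi_free_derivations_axioms.intro semi_free_lifting_axioms.intro)
    show "fst y \<le> 0" if "y \<in> nonpos_coprod X" for y
      using that by (auto simp: nonpos_coprod_def)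
    show "\<exists>k\<in>gr Bt (i - 1). v k = \<zero>\<^bsub>B\<^esub> \<and> dif Bt k = z"
      if "z \<in> gr Bt i" "dif Bt z = \<zero>\<^bsub>Bt\<^esub>" "v z = \<zero>\<^bsub>B\<^esub>" for z i
      by (rule kernel_acyclic[OF Bt B assms(8,7) that])
  qed (use assms \<phi> B Bt Bt' ut ut' v A.nonpos in
      \<open>auto simp: central_hom_def dg_ring.axioms(1) A.dg_ring_axioms A.graded_ring_axioms\<close>)
  show ?thesis by (rule homotopy_exists)
qed

end
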